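(* Let $(\mathsf V,\otimes,I,\sigma)$ be a symmetric monoidal category and let $\mathsf D$ be the associated $\mathsf{Lax}^+_0\mathsf{Oplax}^0_+$-duoidal category of objects of $\mathsf V$ equipped with four pairwise commuting endomorphisms (described in the context). Then: (1) The category of bisemigroups in $\mathsf D$ (regarded as a $\mathsf{Lax}^+\mathsf{Oplax}_+$-duoidal category) and the category of BiHom-bimonoids in $\mathsf V$ are isomorphic. (2) The category of bimonoids in the $\mathsf{Lax}^+_0\mathsf{Oplax}^0_+$-duoidal category $\mathsf D$ and the category of unital and counital BiHom-bimonoids in $\mathsf V$ are isomorphic.
   Context: Mac Lane coherence isomorphisms of $\mathsf V$ are suppressed; $gf$ means first $f$, then $g$. For $m\in\mathbb N$ put $Z(m)=1$ if $m=0$ and $Z(m)=0$ otherwise, and $\overline m=m+Z(m)$. The category $\mathsf D$: objects are $(a,\alpha,\beta,\kappa,\nu)$ with $a$ an object of $\mathsf V$ and $\alpha,\beta,\kappa,\nu$ pairwise commuting endomorphisms of $a$; morphisms are morphisms of $\mathsf V$ commuting with all four endomorphisms. The product functors are $\bullet_n=\circ_n:\mathsf D^n\to\mathsf D$: the object $(I,1,1,1,1)$ for $n=0$ (denoted $j=\bullet_0$ and $i=\circ_0$), the identity functor for $n=1$, the $n$-fold product (of objects, endomorphisms and morphisms) for $n>1$. The coherence transformations are $\iota=1$, $\upsilon=1$ and, for $k_1,\dots,k_n\in\mathbb N$, at objects indexed by $1\le r\le n$, $1\le s\le k_r$, the endomorphisms of $\otimes_{r}\otimes_{s}a_{rs}$: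 $\Phi_{k_1,\dots,k_n}=\otimes_{r}\otimes_{s}\alpha_{rs}^{\sum_{p=r+1}^n(\overline k_p-1)}\beta_{rs}^{\sum_{p=1}^{r-1}(\overline k_p-1)}$, $\phi_{k_1,\dots,k_n}=\otimes_{r}\otimes_{s}\alpha_{rs}^{\sum_{p=r+1}^nZ(k_p)}\beta_{rs}^{\sum_{p=1}^{r-1}Z(k_p)}$, and $\Psi_{k_1,\dots,k_n},\psi_{k_1,\dots,k_n}$ given by the same formulas with $\alpha,\beta$ replaced by $\kappa,\nu$. Here $\Phi_{k_1,\dots,k_n}$ goes from the $n$-fold $\bullet$-product of $k_r$-fold products, and $\phi_{k_1,\dots,k_n}$ from the $(\sum_r k_r)$-fold product, to the $(\sum_r\overline k_r)$-fold product with $\bullet_0$ inserted in the $r$th place whenever $k_r=0$; $\Psi$ and $\psi$ go in the opposite directions with $\circ$ in place of $\bullet$. The morphisms $\xi^p_n:\circ_{r=1}^n(\bullet_{s=1}^pa_{rs})\to\bullet_{s=1}^p(\circ_{r=1}^na_{rs})$, $n,p\ge0$, are the canonical permutation isomorphisms built from $\sigma$. A bisemigroup in a $\mathsf{Lax}^+\mathsf{Oplax}_+$-duoidal category (whose data consist of a category with $n$-fold product functors $\bullet_n$ and $\circ_n$ for all positive integers $n$, and, for all positive integers $n,p,k_1,\dots,k_n$, natural transformations $\Phi_{k_1,\dots,k_n}:\bullet_n(\bullet_{k_1}\cdots\bullet_{k_n})\to\bullet_{k_1+\cdots+k_n}$, $\iota:1\to\bullet_1$, $\Psi_{k_1,\dots,k_n}:\circ_{k_1+\cdots+k_n}\to\circ_n(\circ_{k_1}\cdots\circ_{k_n})$,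 $\upsilon:\circ_1\to1$ and $\xi^p_n:\circ_{r=1}^n(\bullet_{s=1}^pa_{rs})\to\bullet_{s=1}^p(\circ_{r=1}^na_{rs})$) is an object $a$ with $\delta:a\to a\bullet a$ and $\mu:a\circ a\to a$ such that $\Phi_{2,1}(\delta\bullet\iota_a)\delta=\Phi_{1,2}(\iota_a\bullet\delta)\delta$, $\mu(\mu\circ\upsilon_a)\Psi_{2,1}=\mu(\upsilon_a\circ\mu)\Psi_{1,2}$ and $\delta\mu=(\mu\bullet\mu)\xi^2_2(\delta\circ\delta)$. A morphism of bisemigroups is $f:a\to a'$ with $\delta'f=(f\bullet f)\delta$ and $f\mu=\mu'(f\circ f)$. A bimonoid in a $\mathsf{Lax}^+_0\mathsf{Oplax}^0_+$-duoidal category is a bisemigroup $(a,\delta,\mu)$ with morphisms $\varepsilon:a\to j$, $\eta:i\to a$ such that $(\varepsilon\bullet1)\delta=\phi_{0,1}\iota_a$, $(1\bullet\varepsilon)\delta=\phi_{1,0}\iota_a$, $\mu(\eta\circ1)=\upsilon_a\psi_{0,1}$, $\mu(1\circ\eta)=\upsilon_a\psi_{1,0}$, $\varepsilon\mu=\xi^0_2(\varepsilon\circ\varepsilon)$, $\delta\eta=(\eta\bullet\eta)\xi^2_0$, $\varepsilon\eta=\xi^0_0$. A morphism of bimonoids is a bisemigroup morphism $f$ with $\varepsilon'f=\varepsilon$ and $f\eta=\eta'$. A BiHom-monoid in $\mathsf V$ is $(a,\kappa,\nu,\mu)$ with $\kappa\nu=\nu\kappa$, $\kappa\mu=\mu(\kappa\otimes\kappa)$,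 $\nu\mu=\mu(\nu\otimes\nu)$, $\mu(\mu\otimes1)(1\otimes1\otimes\nu)=\mu(1\otimes\mu)(\kappa\otimes1\otimes1)$; a unit is $\eta:I\to a$ with $\kappa\eta=\eta=\nu\eta$, $\mu(\eta\otimes1)=\nu$, $\mu(1\otimes\eta)=\kappa$. A BiHom-comonoid is $(a,\alpha,\beta,\delta)$ with $\alpha\beta=\beta\alpha$, $\delta\alpha=(\alpha\otimes\alpha)\delta$, $\delta\beta=(\beta\otimes\beta)\delta$, $(1\otimes1\otimes\beta)(\delta\otimes1)\delta=(\alpha\otimes1\otimes1)(1\otimes\delta)\delta$; a counit is $\varepsilon:a\to I$ with $\varepsilon\alpha=\varepsilon=\varepsilon\beta$, $(\varepsilon\otimes1)\delta=\beta$, $(1\otimes\varepsilon)\delta=\alpha$. A BiHom-bimonoid in $\mathsf V$ is an object $a$ with a BiHom-monoid structure $(\kappa,\nu,\mu)$ and a BiHom-comonoid structure $(\alpha,\beta,\delta)$ such that $\alpha,\beta,\kappa,\nu$ pairwise commute, $\alpha$ and $\beta$ preserve $\mu$ (i.e. $\alpha\mu=\mu(\alpha\otimes\alpha)$ etc.), $\kappa$ and $\nu$ preserve $\delta$ (i.e. $\delta\kappa=(\kappa\otimes\kappa)\delta$ etc.), and $\delta\mu=(\mu\otimes\mu)(1\otimes\sigma\otimes1)(\delta\otimes\delta)$. It is unital and counital if equipped with a unit $\eta$ and a counit $\varepsilon$ such that $\alpha\eta=\eta=\beta\eta$, $\varepsilon\kappa=\varepsilon=\varepsilon\nu$, $\varepsilon\mu=\varepsilon\otimes\varepsilon$,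 $\delta\eta=\eta\otimes\eta$, $\varepsilon\eta=1$. Morphisms of (unital and counital) BiHom-bimonoids are morphisms of $\mathsf V$ compatible with all four endomorphisms, with $\mu$ and $\delta$ (and with $\eta$ and $\varepsilon$). *)

theory Defs
  imports Main
begin

section \<open>Categories\<close>

text \<open>
  A category is given by a set of objects and a family of hom-sets. The hom-sets need not be
  disjoint (every category with a domain and a codomain map is an instance); this allows the
  morphisms of a category of structured objects to be literally morphisms of the base category.
  The composite \<open>g \<cdot> f\<close> means first \<open>f\<close>, then \<open>g\<close>.
\<close>

record ('o, 'm) cat =
  Obj :: "'o set"
  Hom :: "'o \<Rightarrow> 'o \<Rightarrow> 'm set"
  Ide :: "'o \<Rightarrow> 'm"
  Comp :: "'m \<Rightarrow> 'm \<Rightarrow> 'm"  (infixl "\<cdot>\<index>" 60)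

locale category =
  fixes C :: "('o, 'm, 'x) cat_scheme" (structure)
  assumes Ide_in_Hom: "a \<in> Obj C \<Longrightarrow> Ide C a \<in> Hom C a a"
    and Comp_in_Hom: "\<lbrakk>a \<in> Obj C; b \<in> Obj C; c \<in> Obj C; f \<in> Hom C a b; g \<in> Hom C b c\<rbrakk>
          \<Longrightarrow> g \<cdot> f \<in> Hom C a c"
    and Comp_Ide: "\<lbrakk>a \<in> Obj C; b \<in> Obj C; f \<in> Hom C a b\<rbrakk> \<Longrightarrow> f \<cdot> Ide C a = f"
    and Ide_Comp: "\<lbrakk>a \<in> Obj C; b \<in> Obj C; f \<in> Hom C a b\<rbrakk> \<Longrightarrow> Ide C b \<cdot> f = f"
    and Comp_assoc: "\<lbrakk>a \<in> Obj C; b \<in> Obj C; c \<in> Obj C; d \<in> Obj C;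
          f \<in> Hom C a b; g \<in> Hom C b c; h \<in> Hom C c d\<rbrakk>
          \<Longrightarrow> (h \<cdot> g) \<cdot> f = h \<cdot> (g \<cdot> f)"

definition inverse_arrows :: "('o, 'm, 'x) cat_scheme \<Rightarrow> 'o \<Rightarrow> 'o \<Rightarrow> 'm \<Rightarrow> 'm \<Rightarrow> bool" where
  "inverse_arrows C a b f g \<longleftrightarrow>
     f \<in> Hom C a b \<and> g \<in> Hom C b a \<and> g \<cdot>\<^bsub>C\<^esub> f = Ide C a \<and> f \<cdot>\<^bsub>C\<^esub> g = Ide C b"

definition iso_arrow :: "('o, 'm, 'x) cat_scheme \<Rightarrow> 'o \<Rightarrow> 'o \<Rightarrow> 'm \<Rightarrow> bool" where
  "iso_arrow C a b f \<longleftrightarrow> (\<exists>g. inverse_arrows C a b f g)"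

definition inv_arrow :: "('o, 'm, 'x) cat_scheme \<Rightarrow> 'o \<Rightarrow> 'o \<Rightarrow> 'm \<Rightarrow> 'm" where
  "inv_arrow C a b f = (THE g. inverse_arrows C a b f g)"

definition is_functor ::
  "('o, 'm, 'x) cat_scheme \<Rightarrow> ('p, 'n, 'y) cat_scheme \<Rightarrow> ('o \<Rightarrow> 'p) \<Rightarrow> ('o \<Rightarrow> 'o \<Rightarrow> 'm \<Rightarrow> 'n) \<Rightarrow> bool"
where
  "is_functor A B Fo Fm \<longleftrightarrow>
     (\<forall>a\<in>Obj A. Fo a \<in> Obj B) \<and>
     (\<forall>a\<in>Obj A. \<forall>b\<in>Obj A. \<forall>f\<in>Hom A a b. Fm a b f \<in> Hom B (Fo a) (Fo b)) \<and>
     (\<forall>a\<in>Obj A. Fm a a (Ide A a) = Ide B (Fo a)) \<and>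
     (\<forall>a\<in>Obj A. \<forall>b\<in>Obj A. \<forall>c\<in>Obj A. \<forall>f\<in>Hom A a b. \<forall>g\<in>Hom A b c.
        Fm a c (g \<cdot>\<^bsub>A\<^esub> f) = Fm b c g \<cdot>\<^bsub>B\<^esub> Fm a b f)"

definition isomorphic_categories ::
  "('o, 'm, 'x) cat_scheme \<Rightarrow> ('p, 'n, 'y) cat_scheme \<Rightarrow> bool"
where
  "isomorphic_categories A B \<longleftrightarrow> category A \<and> category B \<and>
     (\<exists>Fo Fm Go Gm. is_functor A B Fo Fm \<and> is_functor B A Go Gm \<and>
        (\<forall>a\<in>Obj A. Go (Fo a) = a) \<and>
        (\<forall>a\<in>Obj A. \<forall>b\<in>Obj A. \<forall>f\<in>Hom A a b. Gm (Fo a) (Fo b) (Fm a b f) = f) \<and>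
        (\<forall>x\<in>Obj B. Fo (Go x) = x) \<and>
        (\<forall>x\<in>Obj B. \<forall>y\<in>Obj B. \<forall>h\<in>Hom B x y. Fm (Go x) (Go y) (Gm x y h) = h))"


section \<open>Symmetric monoidal categories\<close>

record ('o, 'm) moncat = "('o, 'm) cat" +
  Unit :: 'o
  TObj :: "'o \<Rightarrow> 'o \<Rightarrow> 'o"  (infixr "\<otimes>\<^sub>o\<index>" 70)
  TArr :: "'m \<Rightarrow> 'm \<Rightarrow> 'm"  (infixr "\<otimes>\<index>" 70)
  assoc :: "'o \<Rightarrow> 'o \<Rightarrow> 'o \<Rightarrow> 'm"
  lunit :: "'o \<Rightarrow> 'm"
  runit :: "'o \<Rightarrow> 'm"
  symm :: "'o \<Rightarrow> 'o \<Rightarrow> 'm"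

locale symmetric_monoidal_category = category V
  for V :: "('o, 'm, 'x) moncat_scheme" (structure) +
  assumes Unit_Obj: "Unit V \<in> Obj V"
    and TObj_Obj: "\<lbrakk>a \<in> Obj V; b \<in> Obj V\<rbrakk> \<Longrightarrow> a \<otimes>\<^sub>o b \<in> Obj V"
    and TArr_in_Hom: "\<lbrakk>a \<in> Obj V; b \<in> Obj V; c \<in> Obj V; d \<in> Obj V; f \<in> Hom V a b; g \<in> Hom V c d\<rbrakk>
          \<Longrightarrow> f \<otimes> g \<in> Hom V (a \<otimes>\<^sub>o c) (b \<otimes>\<^sub>o d)"
    and TArr_Ide: "\<lbrakk>a \<in> Obj V; b \<in> Obj V\<rbrakk> \<Longrightarrow> Ide V a \<otimes> Ide V b = Ide V (a \<otimes>\<^sub>o b)"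
    and TArr_Comp: "\<lbrakk>a \<in> Obj V; b \<in> Obj V; c \<in> Obj V; a' \<in> Obj V; b' \<in> Obj V; c' \<in> Obj V;
          f \<in> Hom V a b; g \<in> Hom V b c; f' \<in> Hom V a' b'; g' \<in> Hom V b' c'\<rbrakk>
          \<Longrightarrow> (g \<cdot> f) \<otimes> (g' \<cdot> f') = (g \<otimes> g') \<cdot> (f \<otimes> f')"
    and assoc_iso: "\<lbrakk>a \<in> Obj V; b \<in> Obj V; c \<in> Obj V\<rbrakk>
          \<Longrightarrow> iso_arrow V ((a \<otimes>\<^sub>o b) \<otimes>\<^sub>o c) (a \<otimes>\<^sub>o (b \<otimes>\<^sub>o c)) (assoc V a b c)"
    and lunit_iso: "a \<in> Obj V \<Longrightarrow> iso_arrow V (Unit V \<otimes>\<^sub>o a) a (lunit V a)"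
    and runit_iso: "a \<in> Obj V \<Longrightarrow> iso_arrow V (a \<otimes>\<^sub>o Unit V) a (runit V a)"
    and sym_in_Hom: "\<lbrakk>a \<in> Obj V; b \<in> Obj V\<rbrakk> \<Longrightarrow> symm V a b \<in> Hom V (a \<otimes>\<^sub>o b) (b \<otimes>\<^sub>o a)"
    and assoc_natural: "\<lbrakk>a \<in> Obj V; b \<in> Obj V; c \<in> Obj V; a' \<in> Obj V; b' \<in> Obj V; c' \<in> Obj V;
          f \<in> Hom V a a'; g \<in> Hom V b b'; h \<in> Hom V c c'\<rbrakk>
          \<Longrightarrow> assoc V a' b' c' \<cdot> ((f \<otimes> g) \<otimes> h) = (f \<otimes> (g \<otimes> h)) \<cdot> assoc V a b c"
    and lunit_natural: "\<lbrakk>a \<in> Obj V; a' \<in> Obj V; f \<in> Hom V a a'\<rbrakk>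
          \<Longrightarrow> lunit V a' \<cdot> (Ide V (Unit V) \<otimes> f) = f \<cdot> lunit V a"
    and runit_natural: "\<lbrakk>a \<in> Obj V; a' \<in> Obj V; f \<in> Hom V a a'\<rbrakk>
          \<Longrightarrow> runit V a' \<cdot> (f \<otimes> Ide V (Unit V)) = f \<cdot> runit V a"
    and sym_natural: "\<lbrakk>a \<in> Obj V; b \<in> Obj V; a' \<in> Obj V; b' \<in> Obj V; f \<in> Hom V a a'; g \<in> Hom V b b'\<rbrakk>
          \<Longrightarrow> symm V a' b' \<cdot> (f \<otimes> g) = (g \<otimes> f) \<cdot> symm V a b"
    and pentagon: "\<lbrakk>a \<in> Obj V; b \<in> Obj V; c \<in> Obj V; d \<in> Obj V\<rbrakk>
          \<Longrightarrow> (Ide V a \<otimes> assoc V b c d) \<cdot> assoc V a (b \<otimes>\<^sub>o c) d \<cdot> (assoc V a b c \<otimes> Ide V d)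
            = assoc V a b (c \<otimes>\<^sub>o d) \<cdot> assoc V (a \<otimes>\<^sub>o b) c d"
    and triangle: "\<lbrakk>a \<in> Obj V; b \<in> Obj V\<rbrakk>
          \<Longrightarrow> (Ide V a \<otimes> lunit V b) \<cdot> assoc V a (Unit V) b = runit V a \<otimes> Ide V b"
    and sym_sym: "\<lbrakk>a \<in> Obj V; b \<in> Obj V\<rbrakk> \<Longrightarrow> symm V b a \<cdot> symm V a b = Ide V (a \<otimes>\<^sub>o b)"
    and hexagon: "\<lbrakk>a \<in> Obj V; b \<in> Obj V; c \<in> Obj V\<rbrakk>
          \<Longrightarrow> assoc V b c a \<cdot> symm V a (b \<otimes>\<^sub>o c) \<cdot> assoc V a b c
            = (Ide V b \<otimes> symm V a c) \<cdot> assoc V b a c \<cdot> (symm V a b \<otimes> Ide V c)"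


section \<open>Iterated products and the suppressed coherence isomorphisms\<close>

text \<open>Iterated products are bracketed to the right; the 1-fold product is the identity functor.\<close>

fun tens :: "('o, 'm, 'x) moncat_scheme \<Rightarrow> 'o list \<Rightarrow> 'o" where
  "tens V [] = Unit V"
| "tens V [a] = a"
| "tens V (a # b # as) = a \<otimes>\<^sub>o\<^bsub>V\<^esub> tens V (b # as)"

fun tens_arr :: "('o, 'm, 'x) moncat_scheme \<Rightarrow> 'm list \<Rightarrow> 'm" where
  "tens_arr V [] = Ide V (Unit V)"
| "tens_arr V [f] = f"
| "tens_arr V (f # g # fs) = f \<otimes>\<^bsub>V\<^esub> tens_arr V (g # fs)"

text \<open>\<open>merge V as bs : tens V as \<otimes> tens V bs \<rightarrow> tens V (as @ bs)\<close>\<close>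

fun merge :: "('o, 'm, 'x) moncat_scheme \<Rightarrow> 'o list \<Rightarrow> 'o list \<Rightarrow> 'm" where
  "merge V [] bs = lunit V (tens V bs)"
| "merge V [a] [] = runit V a"
| "merge V [a] (b # bs) = Ide V (a \<otimes>\<^sub>o\<^bsub>V\<^esub> tens V (b # bs))"
| "merge V (a # a' # as) bs =
     (Ide V a \<otimes>\<^bsub>V\<^esub> merge V (a' # as) bs) \<cdot>\<^bsub>V\<^esub> assoc V a (tens V (a' # as)) (tens V bs)"

text \<open>\<open>flat V ass : tens V (map (tens V) ass) \<rightarrow> tens V (concat ass)\<close>\<close>

fun flat :: "('o, 'm, 'x) moncat_scheme \<Rightarrow> 'o list list \<Rightarrow> 'm" where
  "flat V [] = Ide V (Unit V)"
| "flat V [as] = Ide V (tens V as)"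
| "flat V (as # bs # ass) =
     merge V as (concat (bs # ass)) \<cdot>\<^bsub>V\<^esub> (Ide V (tens V as) \<otimes>\<^bsub>V\<^esub> flat V (bs # ass))"

definition flat_inv :: "('o, 'm, 'x) moncat_scheme \<Rightarrow> 'o list list \<Rightarrow> 'm" where
  "flat_inv V ass = inv_arrow V (tens V (map (tens V) ass)) (tens V (concat ass)) (flat V ass)"

definition assoc_inv :: "('o, 'm, 'x) moncat_scheme \<Rightarrow> 'o \<Rightarrow> 'o \<Rightarrow> 'o \<Rightarrow> 'm" where
  "assoc_inv V a b c =
     inv_arrow V ((a \<otimes>\<^sub>o\<^bsub>V\<^esub> b) \<otimes>\<^sub>o\<^bsub>V\<^esub> c) (a \<otimes>\<^sub>o\<^bsub>V\<^esub> (b \<otimes>\<^sub>o\<^bsub>V\<^esub> c)) (assoc V a b c)"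

definition lunit_inv :: "('o, 'm, 'x) moncat_scheme \<Rightarrow> 'o \<Rightarrow> 'm" where
  "lunit_inv V a = inv_arrow V (Unit V \<otimes>\<^sub>o\<^bsub>V\<^esub> a) a (lunit V a)"

text \<open>\<open>1 \<otimes> \<sigma> \<otimes> 1 : (a \<otimes> b) \<otimes> (c \<otimes> d) \<rightarrow> (a \<otimes> c) \<otimes> (b \<otimes> d)\<close>, associativity isomorphisms written out\<close>

definition middle_four :: "('o, 'm, 'x) moncat_scheme \<Rightarrow> 'o \<Rightarrow> 'o \<Rightarrow> 'o \<Rightarrow> 'o \<Rightarrow> 'm" where
  "middle_four V a b c d =
     assoc_inv V a c (b \<otimes>\<^sub>o\<^bsub>V\<^esub> d)
     \<cdot>\<^bsub>V\<^esub> (Ide V a \<otimes>\<^bsub>V\<^esub>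
          (assoc V c b d \<cdot>\<^bsub>V\<^esub> (symm V b c \<otimes>\<^bsub>V\<^esub> Ide V d) \<cdot>\<^bsub>V\<^esub> assoc_inv V b c d))
     \<cdot>\<^bsub>V\<^esub> assoc V a b (c \<otimes>\<^sub>o\<^bsub>V\<^esub> d)"

text \<open>
  For lists of equal length,
  \<open>interleave V [a\<^sub>1, \<dots>, a\<^sub>p] [b\<^sub>1, \<dots>, b\<^sub>p] : (\<Otimes>\<^sub>s a\<^sub>s) \<otimes> (\<Otimes>\<^sub>s b\<^sub>s) \<rightarrow> \<Otimes>\<^sub>s (a\<^sub>s \<otimes> b\<^sub>s)\<close>.
\<close>

fun interleave :: "('o, 'm, 'x) moncat_scheme \<Rightarrow> 'o list \<Rightarrow> 'o list \<Rightarrow> 'm" where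
  "interleave V (a # a' # as) (b # b' # bs) =
     (Ide V (a \<otimes>\<^sub>o\<^bsub>V\<^esub> b) \<otimes>\<^bsub>V\<^esub> interleave V (a' # as) (b' # bs))
     \<cdot>\<^bsub>V\<^esub> middle_four V a (tens V (a' # as)) b (tens V (b' # bs))"
| "interleave V [a] [b] = Ide V (a \<otimes>\<^sub>o\<^bsub>V\<^esub> b)"
| "interleave V _ _ = lunit V (Unit V)"

text \<open>
  The argument \<open>rows = [[a\<^sub>1\<^sub>1, \<dots>, a\<^sub>1\<^sub>p], \<dots>, [a\<^sub>n\<^sub>1, \<dots>, a\<^sub>n\<^sub>p]]\<close> encodes the family \<open>a\<^sub>r\<^sub>s\<close>;
  \<open>p\<close> is a separate argument because it cannot be recovered from \<open>rows\<close> when \<open>n = 0\<close>.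
  \<open>perm_iso V p rows : \<Otimes>\<^sub>r \<Otimes>\<^sub>s a\<^sub>r\<^sub>s \<rightarrow> \<Otimes>\<^sub>s \<Otimes>\<^sub>r a\<^sub>r\<^sub>s\<close>.
\<close>

definition columns :: "('o, 'm, 'x) moncat_scheme \<Rightarrow> nat \<Rightarrow> 'o list list \<Rightarrow> 'o list" where
  "columns V p rows = map (\<lambda>s. tens V (map (\<lambda>row. row ! s) rows)) [0..<p]"

fun perm_iso :: "('o, 'm, 'x) moncat_scheme \<Rightarrow> nat \<Rightarrow> 'o list list \<Rightarrow> 'm" where
  "perm_iso V p [] = flat_inv V (replicate p [])"
| "perm_iso V p [as] = Ide V (tens V as)"
| "perm_iso V p (as # bs # rows) =
     interleave V as (columns V p (bs # rows))
     \<cdot>\<^bsub>V\<^esub> (Ide V (tens V as) \<otimes>\<^bsub>V\<^esub> perm_iso V p (bs # rows))"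


section \<open>Duoidal categories: data, bisemigroups and bimonoids\<close>

text \<open>
  Objects and morphisms of the \<open>n\<close>-th power of a category are lists of length \<open>n\<close>, and a family
  indexed by \<open>1 \<le> r \<le> n\<close> and \<open>1 \<le> s \<le> k\<^sub>r\<close> is a list of lists; thus \<open>Phi E [[a, b], [c]]\<close> is the
  component of \<open>\<Phi>\<^sub>2\<^sub>,\<^sub>1\<close> at \<open>a, b, c\<close>. For \<open>xi E p rows\<close> compare \<open>perm_iso\<close>: its upper index is
  \<open>p\<close> and its lower index is the length of \<open>rows\<close>.

  The first record contains \<open>Lax\<^sup>+Oplax\<^sub>+\<close> data; as such only its values at positive \<open>n, p, k\<^sub>r\<close>
  are meaningful. In the \<open>Lax\<^sup>+\<^sub>0Oplax\<^sup>0\<^sub>+\<close> case also zeros are allowed, and then \<open>Phi E ass\<close> and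
  \<open>phi E ass\<close> end (dually, \<open>Psi E ass\<close> and \<open>psi E ass\<close> start) at the product of the concatenation
  of \<open>ass\<close> with the nullary product inserted in place of each empty list. Only the data, not the
  coherence axioms, enter the definition of bisemigroups and bimonoids.
\<close>

record ('o, 'm) lax_oplax_plus = "('o, 'm) cat" +
  bul :: "'o list \<Rightarrow> 'o"
  bul_arr :: "'m list \<Rightarrow> 'm"
  circ :: "'o list \<Rightarrow> 'o"
  circ_arr :: "'m list \<Rightarrow> 'm"
  Phi :: "'o list list \<Rightarrow> 'm"
  iota :: "'o \<Rightarrow> 'm"
  Psi :: "'o list list \<Rightarrow> 'm"
  upsilon :: "'o \<Rightarrow> 'm"
  xi :: "nat \<Rightarrow> 'o list list \<Rightarrow> 'm"

record ('o, 'm) lax_oplax_plus_zero = "('o, 'm) lax_oplax_plus" +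
  phi :: "'o list list \<Rightarrow> 'm"
  psi :: "'o list list \<Rightarrow> 'm"

definition bisemigroup :: "('o, 'm, 'x) lax_oplax_plus_scheme \<Rightarrow> 'o \<Rightarrow> 'm \<Rightarrow> 'm \<Rightarrow> bool" where
  "bisemigroup E a \<delta> \<mu> \<longleftrightarrow>
     a \<in> Obj E \<and> \<delta> \<in> Hom E a (bul E [a, a]) \<and> \<mu> \<in> Hom E (circ E [a, a]) a \<and>
     Phi E [[a, a], [a]] \<cdot>\<^bsub>E\<^esub> bul_arr E [\<delta>, iota E a] \<cdot>\<^bsub>E\<^esub> \<delta>
       = Phi E [[a], [a, a]] \<cdot>\<^bsub>E\<^esub> bul_arr E [iota E a, \<delta>] \<cdot>\<^bsub>E\<^esub> \<delta> \<and>
     \<mu> \<cdot>\<^bsub>E\<^esub> circ_arr E [\<mu>, upsilon E a] \<cdot>\<^bsub>E\<^esub> Psi E [[a, a], [a]]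
       = \<mu> \<cdot>\<^bsub>E\<^esub> circ_arr E [upsilon E a, \<mu>] \<cdot>\<^bsub>E\<^esub> Psi E [[a], [a, a]] \<and>
     \<delta> \<cdot>\<^bsub>E\<^esub> \<mu>
       = bul_arr E [\<mu>, \<mu>] \<cdot>\<^bsub>E\<^esub> xi E 2 [[a, a], [a, a]] \<cdot>\<^bsub>E\<^esub> circ_arr E [\<delta>, \<delta>]"

definition bisemigroup_morphism ::
  "('o, 'm, 'x) lax_oplax_plus_scheme \<Rightarrow> 'o \<times> 'm \<times> 'm \<Rightarrow> 'o \<times> 'm \<times> 'm \<Rightarrow> 'm \<Rightarrow> bool"
where
  "bisemigroup_morphism E = (\<lambda>(a, \<delta>, \<mu>) (a', \<delta>', \<mu>') f.
     f \<in> Hom E a a' \<and>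
     \<delta>' \<cdot>\<^bsub>E\<^esub> f = bul_arr E [f, f] \<cdot>\<^bsub>E\<^esub> \<delta> \<and>
     f \<cdot>\<^bsub>E\<^esub> \<mu> = \<mu>' \<cdot>\<^bsub>E\<^esub> circ_arr E [f, f])"

definition bisemigroups :: "('o, 'm, 'x) lax_oplax_plus_scheme \<Rightarrow> ('o \<times> 'm \<times> 'm, 'm) cat" where
  "bisemigroups E =
     \<lparr> Obj = {(a, \<delta>, \<mu>). bisemigroup E a \<delta> \<mu>},
       Hom = (\<lambda>A A'. {f. bisemigroup_morphism E A A' f}),
       Ide = (\<lambda>(a, \<delta>, \<mu>). Ide E a),
       Comp = Comp E \<rparr>"

definition bimonoid ::
  "('o, 'm, 'x) lax_oplax_plus_zero_scheme \<Rightarrow> 'o \<Rightarrow> 'm \<Rightarrow> 'm \<Rightarrow> 'm \<Rightarrow> 'm \<Rightarrow> bool"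
where
  "bimonoid E a \<delta> \<mu> \<epsilon> \<eta> \<longleftrightarrow>
     bisemigroup E a \<delta> \<mu> \<and>
     \<epsilon> \<in> Hom E a (bul E []) \<and> \<eta> \<in> Hom E (circ E []) a \<and>
     bul_arr E [\<epsilon>, Ide E a] \<cdot>\<^bsub>E\<^esub> \<delta> = phi E [[], [a]] \<cdot>\<^bsub>E\<^esub> iota E a \<and>
     bul_arr E [Ide E a, \<epsilon>] \<cdot>\<^bsub>E\<^esub> \<delta> = phi E [[a], []] \<cdot>\<^bsub>E\<^esub> iota E a \<and>
     \<mu> \<cdot>\<^bsub>E\<^esub> circ_arr E [\<eta>, Ide E a] = upsilon E a \<cdot>\<^bsub>E\<^esub> psi E [[], [a]] \<and>
     \<mu> \<cdot>\<^bsub>E\<^esub> circ_arr E [Ide E a, \<eta>] = upsilon E a \<cdot>\<^bsub>E\<^esub> psi E [[a], []] \<and>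
     \<epsilon> \<cdot>\<^bsub>E\<^esub> \<mu> = xi E 0 [[], []] \<cdot>\<^bsub>E\<^esub> circ_arr E [\<epsilon>, \<epsilon>] \<and>
     \<delta> \<cdot>\<^bsub>E\<^esub> \<eta> = bul_arr E [\<eta>, \<eta>] \<cdot>\<^bsub>E\<^esub> xi E 2 [] \<and>
     \<epsilon> \<cdot>\<^bsub>E\<^esub> \<eta> = xi E 0 []"

definition bimonoids ::
  "('o, 'm, 'x) lax_oplax_plus_zero_scheme \<Rightarrow> ('o \<times> 'm \<times> 'm \<times> 'm \<times> 'm, 'm) cat"
where
  "bimonoids E =
     \<lparr> Obj = {(a, \<delta>, \<mu>, \<epsilon>, \<eta>). bimonoid E a \<delta> \<mu> \<epsilon> \<eta>},
       Hom = (\<lambda>(a, \<delta>, \<mu>, \<epsilon>, \<eta>) (a', \<delta>', \<mu>', \<epsilon>', \<eta>').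
         {f. bisemigroup_morphism E (a, \<delta>, \<mu>) (a', \<delta>', \<mu>') f \<and>
             \<epsilon>' \<cdot>\<^bsub>E\<^esub> f = \<epsilon> \<and> f \<cdot>\<^bsub>E\<^esub> \<eta> = \<eta>'}),
       Ide = (\<lambda>(a, \<delta>, \<mu>, \<epsilon>, \<eta>). Ide E a),
       Comp = Comp E \<rparr>"


section \<open>Objects with four commuting endomorphisms\<close>

datatype ('o, 'm) quad = Quad (und: 'o) (al: 'm) (be: 'm) (ka: 'm) (nu: 'm)

definition commute :: "('o, 'm, 'x) cat_scheme \<Rightarrow> 'm \<Rightarrow> 'm \<Rightarrow> bool" where
  "commute V f g \<longleftrightarrow> f \<cdot>\<^bsub>V\<^esub> g = g \<cdot>\<^bsub>V\<^esub> f"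

definition quad_objects :: "('o, 'm, 'x) cat_scheme \<Rightarrow> ('o, 'm) quad set" where
  "quad_objects V = {x. und x \<in> Obj V \<and>
     {al x, be x, ka x, nu x} \<subseteq> Hom V (und x) (und x) \<and>
     commute V (al x) (be x) \<and> commute V (al x) (ka x) \<and> commute V (al x) (nu x) \<and>
     commute V (be x) (ka x) \<and> commute V (be x) (nu x) \<and> commute V (ka x) (nu x)}"

definition quad_hom :: "('o, 'm, 'x) cat_scheme \<Rightarrow> ('o, 'm) quad \<Rightarrow> ('o, 'm) quad \<Rightarrow> 'm set" where
  "quad_hom V x y = {f \<in> Hom V (und x) (und y).
     f \<cdot>\<^bsub>V\<^esub> al x = al y \<cdot>\<^bsub>V\<^esub> f \<and> f \<cdot>\<^bsub>V\<^esub> be x = be y \<cdot>\<^bsub>V\<^esub> f \<and>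
     f \<cdot>\<^bsub>V\<^esub> ka x = ka y \<cdot>\<^bsub>V\<^esub> f \<and> f \<cdot>\<^bsub>V\<^esub> nu x = nu y \<cdot>\<^bsub>V\<^esub> f}"

definition quad_tens :: "('o, 'm, 'x) moncat_scheme \<Rightarrow> ('o, 'm) quad list \<Rightarrow> ('o, 'm) quad" where
  "quad_tens V xs = Quad (tens V (map und xs)) (tens_arr V (map al xs)) (tens_arr V (map be xs))
     (tens_arr V (map ka xs)) (tens_arr V (map nu xs))"

definition Z :: "nat \<Rightarrow> nat" where
  "Z m = (if m = 0 then 1 else 0)"

definition overline :: "nat \<Rightarrow> nat" where
  "overline m = m + Z m"

definition arr_pow :: "('o, 'm, 'x) cat_scheme \<Rightarrow> 'o \<Rightarrow> 'm \<Rightarrow> nat \<Rightarrow> 'm" where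
  "arr_pow V a f n = ((\<lambda>g. f \<cdot>\<^bsub>V\<^esub> g) ^^ n) (Ide V a)"

text \<open>
  With \<open>k\<^sub>r\<close> the length of the \<open>r\<close>-th list (indices starting from 0), this is
  \<open>\<Otimes>\<^sub>r \<Otimes>\<^sub>s x\<^sub>r\<^sub>s\<close> to the power \<open>\<Sum>p>r. e k\<^sub>p\<close> composed with \<open>y\<^sub>r\<^sub>s\<close> to the power \<open>\<Sum>p<r. e k\<^sub>p\<close>.
\<close>

definition coherence_endo ::
  "('o, 'm, 'x) moncat_scheme \<Rightarrow> (nat \<Rightarrow> nat) \<Rightarrow> (('o, 'm) quad \<Rightarrow> 'm) \<Rightarrow> (('o, 'm) quad \<Rightarrow> 'm)
     \<Rightarrow> ('o, 'm) quad list list \<Rightarrow> 'm"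
where
  "coherence_endo V e x y ass =
     tens_arr V (map (\<lambda>r. tens_arr V (map (\<lambda>a.
         arr_pow V (und a) (x a) (\<Sum>p\<in>{r<..<length ass}. e (length (ass ! p)))
         \<cdot>\<^bsub>V\<^esub> arr_pow V (und a) (y a) (\<Sum>p<r. e (length (ass ! p))))
       (ass ! r))) [0..<length ass])"

text \<open>Inserts the nullary product in the \<open>r\<close>-th place whenever \<open>k\<^sub>r = 0\<close>.\<close>

definition pad :: "'a \<Rightarrow> 'a list list \<Rightarrow> 'a list list" where
  "pad j ass = map (\<lambda>as. if as = [] then [j] else as) ass"

text \<open>
  The canonical isomorphisms between the nested product, the flat product and the padded flat product
  are all given by \<open>flat\<close> and its inverse: since \<open>tens V [] = tens V [Unit V]\<close>, a family and its
  padding have the same nested product.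
\<close>

definition duoidal_D ::
  "('o, 'm, 'x) moncat_scheme \<Rightarrow> (('o, 'm) quad, 'm) lax_oplax_plus_zero"
where
  "duoidal_D V =
    (let U = map (map und);
         P = (\<lambda>ass. map (map und) (pad (quad_tens V []) ass))
     in
     \<lparr> Obj = quad_objects V,
       Hom = quad_hom V,
       Ide = (\<lambda>x. Ide V (und x)),
       Comp = Comp V,
       bul = quad_tens V,
       bul_arr = tens_arr V,
       circ = quad_tens V,
       circ_arr = tens_arr V,
       Phi = (\<lambda>ass. flat V (P ass) \<cdot>\<^bsub>V\<^esub> coherence_endo V (\<lambda>k. overline k - 1) al be ass),
       iota = (\<lambda>x. Ide V (und x)),
       Psi = (\<lambda>ass. coherence_endo V (\<lambda>k. overline k - 1) ka nu ass \<cdot>\<^bsub>V\<^esub> flat_inv V (P ass)),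
       upsilon = (\<lambda>x. Ide V (und x)),
       xi = (\<lambda>p rows. perm_iso V p (U rows)),
       phi = (\<lambda>ass. flat V (P ass) \<cdot>\<^bsub>V\<^esub> coherence_endo V Z al be ass \<cdot>\<^bsub>V\<^esub> flat_inv V (U ass)),
       psi = (\<lambda>ass. flat V (U ass) \<cdot>\<^bsub>V\<^esub> coherence_endo V Z ka nu ass \<cdot>\<^bsub>V\<^esub> flat_inv V (P ass)) \<rparr>)"


section \<open>BiHom-bimonoids\<close>

definition bihom_monoid ::
  "('o, 'm, 'x) moncat_scheme \<Rightarrow> 'o \<Rightarrow> 'm \<Rightarrow> 'm \<Rightarrow> 'm \<Rightarrow> bool"
where
  "bihom_monoid V a \<kappa> \<nu> \<mu> \<longleftrightarrow>
     a \<in> Obj V \<and> \<kappa> \<in> Hom V a a \<and> \<nu> \<in> Hom V a a \<and> \<mu> \<in> Hom V (a \<otimes>\<^sub>o\<^bsub>V\<^esub> a) a \<and>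
     \<kappa> \<cdot>\<^bsub>V\<^esub> \<nu> = \<nu> \<cdot>\<^bsub>V\<^esub> \<kappa> \<and>
     \<kappa> \<cdot>\<^bsub>V\<^esub> \<mu> = \<mu> \<cdot>\<^bsub>V\<^esub> (\<kappa> \<otimes>\<^bsub>V\<^esub> \<kappa>) \<and>
     \<nu> \<cdot>\<^bsub>V\<^esub> \<mu> = \<mu> \<cdot>\<^bsub>V\<^esub> (\<nu> \<otimes>\<^bsub>V\<^esub> \<nu>) \<and>
     \<mu> \<cdot>\<^bsub>V\<^esub> (\<mu> \<otimes>\<^bsub>V\<^esub> Ide V a) \<cdot>\<^bsub>V\<^esub> ((Ide V a \<otimes>\<^bsub>V\<^esub> Ide V a) \<otimes>\<^bsub>V\<^esub> \<nu>)
       = \<mu> \<cdot>\<^bsub>V\<^esub> (Ide V a \<otimes>\<^bsub>V\<^esub> \<mu>) \<cdot>\<^bsub>V\<^esub> (\<kappa> \<otimes>\<^bsub>V\<^esub> (Ide V a \<otimes>\<^bsub>V\<^esub> Ide V a)) \<cdot>\<^bsub>V\<^esub> assoc V a a a"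

definition bihom_unit ::
  "('o, 'm, 'x) moncat_scheme \<Rightarrow> 'o \<Rightarrow> 'm \<Rightarrow> 'm \<Rightarrow> 'm \<Rightarrow> 'm \<Rightarrow> bool"
where
  "bihom_unit V a \<kappa> \<nu> \<mu> \<eta> \<longleftrightarrow>
     \<eta> \<in> Hom V (Unit V) a \<and>
     \<kappa> \<cdot>\<^bsub>V\<^esub> \<eta> = \<eta> \<and> \<nu> \<cdot>\<^bsub>V\<^esub> \<eta> = \<eta> \<and>
     \<mu> \<cdot>\<^bsub>V\<^esub> (\<eta> \<otimes>\<^bsub>V\<^esub> Ide V a) = \<nu> \<cdot>\<^bsub>V\<^esub> lunit V a \<and>
     \<mu> \<cdot>\<^bsub>V\<^esub> (Ide V a \<otimes>\<^bsub>V\<^esub> \<eta>) = \<kappa> \<cdot>\<^bsub>V\<^esub> runit V a"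

definition bihom_comonoid ::
  "('o, 'm, 'x) moncat_scheme \<Rightarrow> 'o \<Rightarrow> 'm \<Rightarrow> 'm \<Rightarrow> 'm \<Rightarrow> bool"
where
  "bihom_comonoid V a \<alpha> \<beta> \<delta> \<longleftrightarrow>
     a \<in> Obj V \<and> \<alpha> \<in> Hom V a a \<and> \<beta> \<in> Hom V a a \<and> \<delta> \<in> Hom V a (a \<otimes>\<^sub>o\<^bsub>V\<^esub> a) \<and>
     \<alpha> \<cdot>\<^bsub>V\<^esub> \<beta> = \<beta> \<cdot>\<^bsub>V\<^esub> \<alpha> \<and>
     \<delta> \<cdot>\<^bsub>V\<^esub> \<alpha> = (\<alpha> \<otimes>\<^bsub>V\<^esub> \<alpha>) \<cdot>\<^bsub>V\<^esub> \<delta> \<and>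
     \<delta> \<cdot>\<^bsub>V\<^esub> \<beta> = (\<beta> \<otimes>\<^bsub>V\<^esub> \<beta>) \<cdot>\<^bsub>V\<^esub> \<delta> \<and>
     assoc V a a a \<cdot>\<^bsub>V\<^esub> ((Ide V a \<otimes>\<^bsub>V\<^esub> Ide V a) \<otimes>\<^bsub>V\<^esub> \<beta>) \<cdot>\<^bsub>V\<^esub> (\<delta> \<otimes>\<^bsub>V\<^esub> Ide V a) \<cdot>\<^bsub>V\<^esub> \<delta>
       = (\<alpha> \<otimes>\<^bsub>V\<^esub> (Ide V a \<otimes>\<^bsub>V\<^esub> Ide V a)) \<cdot>\<^bsub>V\<^esub> (Ide V a \<otimes>\<^bsub>V\<^esub> \<delta>) \<cdot>\<^bsub>V\<^esub> \<delta>"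

definition bihom_counit ::
  "('o, 'm, 'x) moncat_scheme \<Rightarrow> 'o \<Rightarrow> 'm \<Rightarrow> 'm \<Rightarrow> 'm \<Rightarrow> 'm \<Rightarrow> bool"
where
  "bihom_counit V a \<alpha> \<beta> \<delta> \<epsilon> \<longleftrightarrow>
     \<epsilon> \<in> Hom V a (Unit V) \<and>
     \<epsilon> \<cdot>\<^bsub>V\<^esub> \<alpha> = \<epsilon> \<and> \<epsilon> \<cdot>\<^bsub>V\<^esub> \<beta> = \<epsilon> \<and>
     lunit V a \<cdot>\<^bsub>V\<^esub> (\<epsilon> \<otimes>\<^bsub>V\<^esub> Ide V a) \<cdot>\<^bsub>V\<^esub> \<delta> = \<beta> \<and>
     runit V a \<cdot>\<^bsub>V\<^esub> (Ide V a \<otimes>\<^bsub>V\<^esub> \<epsilon>) \<cdot>\<^bsub>V\<^esub> \<delta> = \<alpha>"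

definition bihom_bimonoid ::
  "('o, 'm, 'x) moncat_scheme \<Rightarrow> 'o \<Rightarrow> 'm \<Rightarrow> 'm \<Rightarrow> 'm \<Rightarrow> 'm \<Rightarrow> 'm \<Rightarrow> 'm \<Rightarrow> bool"
where
  "bihom_bimonoid V a \<kappa> \<nu> \<mu> \<alpha> \<beta> \<delta> \<longleftrightarrow>
     bihom_monoid V a \<kappa> \<nu> \<mu> \<and> bihom_comonoid V a \<alpha> \<beta> \<delta> \<and>
     commute V \<alpha> \<beta> \<and> commute V \<alpha> \<kappa> \<and> commute V \<alpha> \<nu> \<and>
     commute V \<beta> \<kappa> \<and> commute V \<beta> \<nu> \<and> commute V \<kappa> \<nu> \<and>
     \<alpha> \<cdot>\<^bsub>V\<^esub> \<mu> = \<mu> \<cdot>\<^bsub>V\<^esub> (\<alpha> \<otimes>\<^bsub>V\<^esub> \<alpha>) \<and>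
     \<beta> \<cdot>\<^bsub>V\<^esub> \<mu> = \<mu> \<cdot>\<^bsub>V\<^esub> (\<beta> \<otimes>\<^bsub>V\<^esub> \<beta>) \<and>
     \<delta> \<cdot>\<^bsub>V\<^esub> \<kappa> = (\<kappa> \<otimes>\<^bsub>V\<^esub> \<kappa>) \<cdot>\<^bsub>V\<^esub> \<delta> \<and>
     \<delta> \<cdot>\<^bsub>V\<^esub> \<nu> = (\<nu> \<otimes>\<^bsub>V\<^esub> \<nu>) \<cdot>\<^bsub>V\<^esub> \<delta> \<and>
     \<delta> \<cdot>\<^bsub>V\<^esub> \<mu> = (\<mu> \<otimes>\<^bsub>V\<^esub> \<mu>) \<cdot>\<^bsub>V\<^esub> middle_four V a a a a \<cdot>\<^bsub>V\<^esub> (\<delta> \<otimes>\<^bsub>V\<^esub> \<delta>)"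

definition unital_counital_bihom_bimonoid ::
  "('o, 'm, 'x) moncat_scheme \<Rightarrow> 'o \<Rightarrow> 'm \<Rightarrow> 'm \<Rightarrow> 'm \<Rightarrow> 'm \<Rightarrow> 'm \<Rightarrow> 'm \<Rightarrow> 'm \<Rightarrow> 'm \<Rightarrow> bool"
where
  "unital_counital_bihom_bimonoid V a \<kappa> \<nu> \<mu> \<alpha> \<beta> \<delta> \<eta> \<epsilon> \<longleftrightarrow>
     bihom_bimonoid V a \<kappa> \<nu> \<mu> \<alpha> \<beta> \<delta> \<and>
     bihom_unit V a \<kappa> \<nu> \<mu> \<eta> \<and> bihom_counit V a \<alpha> \<beta> \<delta> \<epsilon> \<and>
     \<alpha> \<cdot>\<^bsub>V\<^esub> \<eta> = \<eta> \<and> \<beta> \<cdot>\<^bsub>V\<^esub> \<eta> = \<eta> \<and> \<epsilon> \<cdot>\<^bsub>V\<^esub> \<kappa> = \<epsilon> \<and> \<epsilon> \<cdot>\<^bsub>V\<^esub> \<nu> = \<epsilon> \<and>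
     \<epsilon> \<cdot>\<^bsub>V\<^esub> \<mu> = lunit V (Unit V) \<cdot>\<^bsub>V\<^esub> (\<epsilon> \<otimes>\<^bsub>V\<^esub> \<epsilon>) \<and>
     \<delta> \<cdot>\<^bsub>V\<^esub> \<eta> = (\<eta> \<otimes>\<^bsub>V\<^esub> \<eta>) \<cdot>\<^bsub>V\<^esub> lunit_inv V (Unit V) \<and>
     \<epsilon> \<cdot>\<^bsub>V\<^esub> \<eta> = Ide V (Unit V)"

definition bihom_bimonoid_morphism ::
  "('o, 'm, 'x) moncat_scheme \<Rightarrow> 'o \<times> 'm \<times> 'm \<times> 'm \<times> 'm \<times> 'm \<times> 'm
     \<Rightarrow> 'o \<times> 'm \<times> 'm \<times> 'm \<times> 'm \<times> 'm \<times> 'm \<Rightarrow> 'm \<Rightarrow> bool"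
where
  "bihom_bimonoid_morphism V = (\<lambda>(a, \<kappa>, \<nu>, \<mu>, \<alpha>, \<beta>, \<delta>) (a', \<kappa>', \<nu>', \<mu>', \<alpha>', \<beta>', \<delta>') f.
     f \<in> Hom V a a' \<and>
     f \<cdot>\<^bsub>V\<^esub> \<kappa> = \<kappa>' \<cdot>\<^bsub>V\<^esub> f \<and> f \<cdot>\<^bsub>V\<^esub> \<nu> = \<nu>' \<cdot>\<^bsub>V\<^esub> f \<and>
     f \<cdot>\<^bsub>V\<^esub> \<alpha> = \<alpha>' \<cdot>\<^bsub>V\<^esub> f \<and> f \<cdot>\<^bsub>V\<^esub> \<beta> = \<beta>' \<cdot>\<^bsub>V\<^esub> f \<and>
     f \<cdot>\<^bsub>V\<^esub> \<mu> = \<mu>' \<cdot>\<^bsub>V\<^esub> (f \<otimes>\<^bsub>V\<^esub> f) \<and>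
     \<delta>' \<cdot>\<^bsub>V\<^esub> f = (f \<otimes>\<^bsub>V\<^esub> f) \<cdot>\<^bsub>V\<^esub> \<delta>)"

definition bihom_bimonoids ::
  "('o, 'm, 'x) moncat_scheme \<Rightarrow> ('o \<times> 'm \<times> 'm \<times> 'm \<times> 'm \<times> 'm \<times> 'm, 'm) cat"
where
  "bihom_bimonoids V =
     \<lparr> Obj = {(a, \<kappa>, \<nu>, \<mu>, \<alpha>, \<beta>, \<delta>). bihom_bimonoid V a \<kappa> \<nu> \<mu> \<alpha> \<beta> \<delta>},
       Hom = (\<lambda>A A'. {f. bihom_bimonoid_morphism V A A' f}),
       Ide = (\<lambda>(a, \<kappa>, \<nu>, \<mu>, \<alpha>, \<beta>, \<delta>). Ide V a),
       Comp = Comp V \<rparr>"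

definition unital_counital_bihom_bimonoids ::
  "('o, 'm, 'x) moncat_scheme
     \<Rightarrow> ('o \<times> 'm \<times> 'm \<times> 'm \<times> 'm \<times> 'm \<times> 'm \<times> 'm \<times> 'm, 'm) cat"
where
  "unital_counital_bihom_bimonoids V =
     \<lparr> Obj = {(a, \<kappa>, \<nu>, \<mu>, \<alpha>, \<beta>, \<delta>, \<eta>, \<epsilon>).
         unital_counital_bihom_bimonoid V a \<kappa> \<nu> \<mu> \<alpha> \<beta> \<delta> \<eta> \<epsilon>},
       Hom = (\<lambda>(a, \<kappa>, \<nu>, \<mu>, \<alpha>, \<beta>, \<delta>, \<eta>, \<epsilon>) (a', \<kappa>', \<nu>', \<mu>', \<alpha>', \<beta>', \<delta>', \<eta>', \<epsilon>').
         {f. bihom_bimonoid_morphism V (a, \<kappa>, \<nu>, \<mu>, \<alpha>, \<beta>, \<delta>) (a', \<kappa>', \<nu>', \<mu>', \<alpha>', \<beta>', \<delta>') f \<and>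
             f \<cdot>\<^bsub>V\<^esub> \<eta> = \<eta>' \<and> \<epsilon>' \<cdot>\<^bsub>V\<^esub> f = \<epsilon>}),
       Ide = (\<lambda>(a, \<kappa>, \<nu>, \<mu>, \<alpha>, \<beta>, \<delta>, \<eta>, \<epsilon>). Ide V a),
       Comp = Comp V \<rparr>"

end

theory Submission
  imports Defs
begin

text \<open>
  The two kinds of structure consist of the same data: an object of \<open>\<D>\<close> is an object of the base
  category with four commuting endomorphisms, and a bisemigroup in \<open>\<D>\<close> adds to it the same
  morphisms \<open>\<delta>\<close> and \<open>\<mu>\<close> as a BiHom-bimonoid does, a bimonoid also \<open>\<epsilon>\<close> and \<open>\<eta>\<close>. That these are morphisms
  of \<open>\<D>\<close> says exactly that all four endomorphisms preserve them. Evaluating the coherence data gives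
  \<open>\<Phi>\<^sub>2\<^sub>,\<^sub>1 = 1 \<otimes> 1 \<otimes> \<beta>\<close>, \<open>\<Phi>\<^sub>1\<^sub>,\<^sub>2 = \<alpha> \<otimes> 1 \<otimes> 1\<close>, \<open>\<phi>\<^sub>0\<^sub>,\<^sub>1 = \<beta>\<close> and \<open>\<phi>\<^sub>1\<^sub>,\<^sub>0 = \<alpha>\<close> up to the associativity and unit
  isomorphisms, and dually for \<open>\<Psi>\<close> and \<open>\<psi>\<close> with \<open>\<kappa>\<close> and \<open>\<nu>\<close>, while \<open>\<xi>\<^sup>2\<^sub>2\<close> is the middle-four interchange
  and each of \<open>\<xi>\<^sup>0\<^sub>0\<close>, \<open>\<xi>\<^sup>0\<^sub>2\<close>, \<open>\<xi>\<^sup>2\<^sub>0\<close> is the identity, a unit isomorphism, or the inverse of one. Hence coassociativity, associativity, the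
  (co)unit laws and the compatibility conditions of the two structures become literally equal, or
  equivalent after moving one associativity or unit isomorphism to the other side of an equation
  (\<open>bisemigroup_iff\<close>, \<open>bimonoid_iff\<close>).

  The two sorts of morphisms are then the same morphisms of the base category, so that reordering the
  components of an object, with the identity on morphisms, is an isomorphism of categories
  (\<open>isomorphic_categories_if_same_arrows\<close>).
\<close>

section \<open>Invertible morphisms and concrete categories\<close>

context category
begin

lemma inverse_arrows_unique:
  assumes "a \<in> Obj C" "b \<in> Obj C" "inverse_arrows C a b f g" "inverse_arrows C a b f h"
  shows "g = h"
proof -
  have "g = g \<cdot> (f \<cdot> h)"
    using assms Comp_Ide[of b a g] by (simp add: inverse_arrows_def)
  also have "\<dots> = (g \<cdot> f) \<cdot> h"
    using assms Comp_assoc[of b a b a h f g] by (simp add: inverse_arrows_def)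
  also have "\<dots> = h"
    using assms Ide_Comp[of b a h] by (simp add: inverse_arrows_def)
  finally show ?thesis .
qed

lemma inverse_arrows_inv_arrow:
  assumes "a \<in> Obj C" "b \<in> Obj C" "iso_arrow C a b f"
  shows "inverse_arrows C a b f (inv_arrow C a b f)"
proof -
  have "\<exists>!g. inverse_arrows C a b f g"
    using assms inverse_arrows_unique unfolding iso_arrow_def by blast
  then show ?thesis
    unfolding inv_arrow_def by (rule theI')
qed

lemma iso_arrow_in_Hom: "iso_arrow C a b f \<Longrightarrow> f \<in> Hom C a b"
  by (auto simp: iso_arrow_def inverse_arrows_def)

lemma inverse_arrows_Ide: "a \<in> Obj C \<Longrightarrow> inverse_arrows C a a (Ide C a) (Ide C a)"
  by (simp add: inverse_arrows_def Ide_in_Hom Comp_Ide)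

lemma inv_arrow_Ide: "a \<in> Obj C \<Longrightarrow> inv_arrow C a a (Ide C a) = Ide C a"
  by (metis inverse_arrows_Ide inverse_arrows_inv_arrow inverse_arrows_unique iso_arrow_def)

lemma Comp_inverse_right_eq_iff:
  assumes "a \<in> Obj C" "b \<in> Obj C" "c \<in> Obj C" "inverse_arrows C a b u v"
    and "f \<in> Hom C a c" "g \<in> Hom C b c"
  shows "f \<cdot> v = g \<longleftrightarrow> f = g \<cdot> u"
proof -
  have "(f \<cdot> v) \<cdot> u = f" "(g \<cdot> u) \<cdot> v = g"
    using assms Comp_assoc[of a b a c u v f] Comp_assoc[of b a b c v u g]
    by (simp_all add: inverse_arrows_def Comp_Ide)
  then show ?thesis by auto
qed

lemma Comp_inverse_left_eq_iff:
  assumes "a \<in> Obj C" "b \<in> Obj C" "c \<in> Obj C" "inverse_arrows C a b u v"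
    and "f \<in> Hom C c a" "g \<in> Hom C c b"
  shows "f = v \<cdot> g \<longleftrightarrow> u \<cdot> f = g"
proof -
  have "v \<cdot> (u \<cdot> f) = f" "u \<cdot> (v \<cdot> g) = g"
    using assms Comp_assoc[of c a b a f u v] Comp_assoc[of c b a b g v u]
    by (simp_all add: inverse_arrows_def Ide_Comp)
  then show ?thesis by auto
qed

text \<open>
  A morphism \<open>f : b \<rightarrow> a\<close> is the composite \<open>h \<cdot> u\<inverse>\<close> if and only if \<open>u \<cdot> f = g\<close>, where \<open>u\<close>
  intertwines the endomorphisms \<open>h\<close> and \<open>g\<close>. With a unit isomorphism as \<open>u\<close>, this compares the two
  forms of a counit law.
\<close>

lemma Comp_intertwiner_inverse_eq_iff:
  assumes "a \<in> Obj C" "b \<in> Obj C" "inverse_arrows C a b u v"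
    and "h \<in> Hom C a a" "g \<in> Hom C b b" "u \<cdot> h = g \<cdot> u" "f \<in> Hom C b a"
  shows "f = h \<cdot> v \<longleftrightarrow> u \<cdot> f = g"
proof -
  have u: "u \<in> Hom C a b" and v: "v \<in> Hom C b a" and uv: "u \<cdot> v = Ide C b"
    using assms(3) by (simp_all add: inverse_arrows_def)
  have "u \<cdot> (h \<cdot> v) = (u \<cdot> h) \<cdot> v"
    using assms u v Comp_assoc[of b a a b v h u] by simp
  also have "\<dots> = g"
    using assms u v uv Comp_assoc[of b a b b v u g] Comp_Ide[of b b g] by simp
  finally have "h \<cdot> v = v \<cdot> g"
    using assms v Comp_in_Hom[of b a a v h] Comp_inverse_left_eq_iff[of a b b u v "h \<cdot> v" g] by simp
  then show ?thesis
    using assms Comp_inverse_left_eq_iff[of a b b u v f g] by simp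
qed

text \<open>Structured objects whose morphisms are morphisms of the underlying objects form a category.\<close>

lemma concrete_category:
  fixes A :: "('p, 'm, 'y) cat_scheme" and U :: "'p \<Rightarrow> 'o"
  assumes "\<And>x. x \<in> Obj A \<Longrightarrow> U x \<in> Obj C"
    and "\<And>x y f. \<lbrakk>x \<in> Obj A; y \<in> Obj A; f \<in> Hom A x y\<rbrakk> \<Longrightarrow> f \<in> Hom C (U x) (U y)"
    and "\<And>x. x \<in> Obj A \<Longrightarrow> Ide A x = Ide C (U x)"
    and "Comp A = Comp C"
    and "\<And>x. x \<in> Obj A \<Longrightarrow> Ide C (U x) \<in> Hom A x x"
    and "\<And>x y z f g. \<lbrakk>x \<in> Obj A; y \<in> Obj A; z \<in> Obj A; f \<in> Hom A x y; g \<in> Hom A y z\<rbrakk>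
           \<Longrightarrow> g \<cdot> f \<in> Hom A x z"
  shows "category A"
proof
  fix x y z w f g h
  assume "x \<in> Obj A" "y \<in> Obj A" "z \<in> Obj A" "w \<in> Obj A"
    and "f \<in> Hom A x y" "g \<in> Hom A y z" "h \<in> Hom A z w"
  then show "h \<cdot>\<^bsub>A\<^esub> g \<cdot>\<^bsub>A\<^esub> f = h \<cdot>\<^bsub>A\<^esub> (g \<cdot>\<^bsub>A\<^esub> f)"
    using assms(1,2) Comp_assoc[of "U x" "U y" "U z" "U w" f g h] by (simp add: assms(4))
next
  fix x y f
  assume "x \<in> Obj A" "y \<in> Obj A" "f \<in> Hom A x y"
  then show "f \<cdot>\<^bsub>A\<^esub> Ide A x = f" "Ide A y \<cdot>\<^bsub>A\<^esub> f = f"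
    using assms(1,2) Comp_Ide[of "U x" "U y" f] Ide_Comp[of "U x" "U y" f]
    by (simp_all add: assms(3,4))
qed (use assms in simp_all)

end

text \<open>That \<open>A\<close> is a category need not be assumed: its structure is transported along \<open>F\<close>.\<close>

lemma isomorphic_categories_if_same_arrows:
  fixes A :: "('o, 'm, 'x) cat_scheme" and B :: "('p, 'm, 'y) cat_scheme"
  assumes B: "category B"
    and F: "\<And>a. a \<in> Obj A \<Longrightarrow> F a \<in> Obj B" and G: "\<And>x. x \<in> Obj B \<Longrightarrow> G x \<in> Obj A"
    and GF: "\<And>a. a \<in> Obj A \<Longrightarrow> G (F a) = a" and FG: "\<And>x. x \<in> Obj B \<Longrightarrow> F (G x) = x"
    and Hom: "\<And>a b. \<lbrakk>a \<in> Obj A; b \<in> Obj A\<rbrakk> \<Longrightarrow> Hom A a b = Hom B (F a) (F b)"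
    and Ide: "\<And>a. a \<in> Obj A \<Longrightarrow> Ide A a = Ide B (F a)"
    and Comp: "Comp A = Comp B"
  shows "isomorphic_categories A B"
proof -
  interpret B: category B by fact
  have "category A"
  proof (rule B.concrete_category[where U = F])
    show "g \<cdot>\<^bsub>B\<^esub> f \<in> Hom A a c"
      if "a \<in> Obj A" "b \<in> Obj A" "c \<in> Obj A" "f \<in> Hom A a b" "g \<in> Hom A b c" for a b c f g
      using that B.Comp_in_Hom[of "F a" "F b" "F c" f g] by (simp add: F Hom)
  qed (use F Hom Ide Comp B.Ide_in_Hom in simp_all)
  moreover have "is_functor A B F (\<lambda>_ _ f. f)"
    using F Hom Ide Comp by (simp add: is_functor_def)
  moreover have "is_functor B A G (\<lambda>_ _ f. f)"
    using G Hom Ide Comp FG by (simp add: is_functor_def)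
  ultimately show ?thesis
    unfolding isomorphic_categories_def using B GF FG by blast
qed

section \<open>Evaluation of the coherence data\<close>

text \<open>For two factors each exponent is a single summand or an empty sum.\<close>

lemma coherence_endo_two:
  "coherence_endo V e x y [as, bs] =
     tens_arr V (map (\<lambda>a. arr_pow V (und a) (x a) (e (length bs)) \<cdot>\<^bsub>V\<^esub> arr_pow V (und a) (y a) 0) as)
     \<otimes>\<^bsub>V\<^esub> tens_arr V (map (\<lambda>a. arr_pow V (und a) (x a) 0 \<cdot>\<^bsub>V\<^esub> arr_pow V (und a) (y a) (e (length as))) bs)"
proof -
  have "{0<..<Suc (Suc 0)} = {Suc 0}" "{Suc 0<..<Suc (Suc 0)} = {}"
    by auto
  then show ?thesis
    by (simp add: coherence_endo_def)
qed

lemma arr_pow_0: "arr_pow V a f 0 = Ide V a"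
  by (simp add: arr_pow_def)

lemma (in category) arr_pow_1: "\<lbrakk>a \<in> Obj C; f \<in> Hom C a a\<rbrakk> \<Longrightarrow> arr_pow C a f (Suc 0) = f"
  by (simp add: arr_pow_def Comp_Ide)

lemma duoidal_D_simps:
  "Obj (duoidal_D V) = quad_objects V" "Hom (duoidal_D V) = quad_hom V"
  "Ide (duoidal_D V) y = Ide V (und y)" "Comp (duoidal_D V) = Comp V"
  "bul (duoidal_D V) = quad_tens V" "bul_arr (duoidal_D V) = tens_arr V"
  "circ (duoidal_D V) = quad_tens V" "circ_arr (duoidal_D V) = tens_arr V"
  "iota (duoidal_D V) y = Ide V (und y)" "upsilon (duoidal_D V) y = Ide V (und y)"
  by (simp_all add: duoidal_D_def Let_def)

lemma bisemigroups_truncate: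
  "bisemigroups (lax_oplax_plus.truncate E) = bisemigroups E"
  by (simp add: bisemigroups_def bisemigroup_def bisemigroup_morphism_def
      lax_oplax_plus.defs fun_eq_iff)

context symmetric_monoidal_category
begin

lemma assoc_inverse:
  assumes "a \<in> Obj V" "b \<in> Obj V" "c \<in> Obj V"
  shows "inverse_arrows V ((a \<otimes>\<^sub>o b) \<otimes>\<^sub>o c) (a \<otimes>\<^sub>o (b \<otimes>\<^sub>o c)) (assoc V a b c) (assoc_inv V a b c)"
  using assms unfolding assoc_inv_def
  by (intro inverse_arrows_inv_arrow assoc_iso TObj_Obj)

lemma lunit_inverse: "a \<in> Obj V \<Longrightarrow> inverse_arrows V (Unit V \<otimes>\<^sub>o a) a (lunit V a) (lunit_inv V a)"
  unfolding lunit_inv_def by (intro inverse_arrows_inv_arrow lunit_iso TObj_Obj Unit_Obj)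

lemma runit_inverse:
  "a \<in> Obj V \<Longrightarrow>
    inverse_arrows V (a \<otimes>\<^sub>o Unit V) a (runit V a) (inv_arrow V (a \<otimes>\<^sub>o Unit V) a (runit V a))"
  by (intro inverse_arrows_inv_arrow runit_iso TObj_Obj Unit_Obj)

lemma assoc_in_Hom:
  "\<lbrakk>a \<in> Obj V; b \<in> Obj V; c \<in> Obj V\<rbrakk>
    \<Longrightarrow> assoc V a b c \<in> Hom V ((a \<otimes>\<^sub>o b) \<otimes>\<^sub>o c) (a \<otimes>\<^sub>o (b \<otimes>\<^sub>o c))"
  by (rule iso_arrow_in_Hom[OF assoc_iso])

lemma assoc_inv_in_Hom:
  "\<lbrakk>a \<in> Obj V; b \<in> Obj V; c \<in> Obj V\<rbrakk>
    \<Longrightarrow> assoc_inv V a b c \<in> Hom V (a \<otimes>\<^sub>o (b \<otimes>\<^sub>o c)) ((a \<otimes>\<^sub>o b) \<otimes>\<^sub>o c)"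
  using assoc_inverse by (simp add: inverse_arrows_def)

lemma lunit_in_Hom: "a \<in> Obj V \<Longrightarrow> lunit V a \<in> Hom V (Unit V \<otimes>\<^sub>o a) a"
  by (rule iso_arrow_in_Hom[OF lunit_iso])

lemma runit_in_Hom: "a \<in> Obj V \<Longrightarrow> runit V a \<in> Hom V (a \<otimes>\<^sub>o Unit V) a"
  by (rule iso_arrow_in_Hom[OF runit_iso])

lemmas closed_simps =
  Unit_Obj TObj_Obj Ide_in_Hom TArr_in_Hom sym_in_Hom
  assoc_in_Hom assoc_inv_in_Hom lunit_in_Hom runit_in_Hom

lemma middle_four_in_Hom:
  assumes "a \<in> Obj V" "b \<in> Obj V" "c \<in> Obj V" "d \<in> Obj V"
  shows "middle_four V a b c d \<in> Hom V ((a \<otimes>\<^sub>o b) \<otimes>\<^sub>o (c \<otimes>\<^sub>o d)) ((a \<otimes>\<^sub>o c) \<otimes>\<^sub>o (b \<otimes>\<^sub>o d))"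
proof -
  have "assoc V c b d \<cdot> (symm V b c \<otimes> Ide V d) \<cdot> assoc_inv V b c d
      \<in> Hom V (b \<otimes>\<^sub>o (c \<otimes>\<^sub>o d)) (c \<otimes>\<^sub>o (b \<otimes>\<^sub>o d))"
    using assms
    by (intro Comp_in_Hom[where b = "(b \<otimes>\<^sub>o c) \<otimes>\<^sub>o d"] Comp_in_Hom[where b = "(c \<otimes>\<^sub>o b) \<otimes>\<^sub>o d"])
      (simp_all add: closed_simps)
  then show ?thesis
    using assms unfolding middle_four_def
    by (intro Comp_in_Hom[where b = "a \<otimes>\<^sub>o (b \<otimes>\<^sub>o (c \<otimes>\<^sub>o d))"]
        Comp_in_Hom[where b = "a \<otimes>\<^sub>o (c \<otimes>\<^sub>o (b \<otimes>\<^sub>o d))"])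
      (simp_all add: closed_simps)
qed

end

text \<open>A symmetric monoidal category with a chosen object \<open>q = (a, \<alpha>, \<beta>, \<kappa>, \<nu>)\<close> of \<open>\<D>\<close>.\<close>

locale quad_object = symmetric_monoidal_category V
  for V :: "('o, 'm, 'x) moncat_scheme" (structure) +
  fixes a :: 'o and \<alpha> \<beta> \<kappa> \<nu> :: 'm
  assumes quad_object: "Quad a \<alpha> \<beta> \<kappa> \<nu> \<in> quad_objects V"
begin

abbreviation "q \<equiv> Quad a \<alpha> \<beta> \<kappa> \<nu>"

lemma a_Obj: "a \<in> Obj V"
  and endo_in_Hom: "\<alpha> \<in> Hom V a a" "\<beta> \<in> Hom V a a" "\<kappa> \<in> Hom V a a" "\<nu> \<in> Hom V a a"
  using quad_object by (simp_all add: quad_objects_def)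

lemmas endo_simps = a_Obj endo_in_Hom closed_simps

lemma Ide_Comp_Ide: "b \<in> Obj V \<Longrightarrow> Ide V b \<cdot> Ide V b = Ide V b"
  using Comp_Ide[OF _ _ Ide_in_Hom] by simp

lemmas coherence_simps =
  duoidal_D_def Let_def pad_def quad_tens_def coherence_endo_two overline_def Z_def
  arr_pow_0 arr_pow_1 Comp_Ide[of a a] Ide_Comp[of a a]

lemma flat_two_one: "flat V [[a, a], [a]] = assoc V a a a"
  by (simp add: TArr_Ide endo_simps Comp_Ide[OF _ _ assoc_in_Hom] Ide_Comp[OF _ _ assoc_in_Hom])

lemma flat_one_two: "flat V [[a], [a, a]] = Ide V (a \<otimes>\<^sub>o a \<otimes>\<^sub>o a)"
  by (simp add: TArr_Ide endo_simps Ide_Comp_Ide)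

lemma flat_one_one:
  "\<lbrakk>b \<in> Obj V; c \<in> Obj V\<rbrakk> \<Longrightarrow> flat V [[b], [c]] = Ide V (b \<otimes>\<^sub>o c)"
  by (simp add: TArr_Ide endo_simps Ide_Comp_Ide)

lemma flat_zero_one: "flat V [[], [a]] = lunit V a"
  by (simp add: TArr_Ide endo_simps Comp_Ide[OF _ _ lunit_in_Hom])

lemma flat_one_zero: "flat V [[a], []] = runit V a"
  by (simp add: TArr_Ide endo_simps Comp_Ide[OF _ _ runit_in_Hom])

lemma flat_zero_zero: "flat V [[], []] = lunit V (Unit V)"
  by (simp add: TArr_Ide endo_simps Comp_Ide[OF _ _ lunit_in_Hom])

lemmas flat_simps =
  flat_two_one flat_one_two flat_one_one flat_zero_one flat_one_zero flat_zero_zero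

lemma Phi_two_one:
  "Phi (duoidal_D V) [[q, q], [q]] = assoc V a a a \<cdot> ((Ide V a \<otimes> Ide V a) \<otimes> \<beta>)"
  by (simp add: coherence_simps endo_simps flat_simps del: flat.simps)

lemma Phi_one_two: "Phi (duoidal_D V) [[q], [q, q]] = \<alpha> \<otimes> (Ide V a \<otimes> Ide V a)"
proof -
  have "\<alpha> \<otimes> (Ide V a \<otimes> Ide V a) \<in> Hom V (a \<otimes>\<^sub>o a \<otimes>\<^sub>o a) (a \<otimes>\<^sub>o a \<otimes>\<^sub>o a)"
    by (simp add: endo_simps)
  from Ide_Comp[OF _ _ this] show ?thesis
    by (simp add: coherence_simps endo_simps flat_simps del: flat.simps)
qed

lemma Psi_two_one:
  "Psi (duoidal_D V) [[q, q], [q]] = ((Ide V a \<otimes> Ide V a) \<otimes> \<nu>) \<cdot> assoc_inv V a a a"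
  by (simp add: coherence_simps endo_simps flat_inv_def assoc_inv_def flat_simps del: flat.simps)

lemma Psi_one_two: "Psi (duoidal_D V) [[q], [q, q]] = \<kappa> \<otimes> (Ide V a \<otimes> Ide V a)"
proof -
  have "\<kappa> \<otimes> (Ide V a \<otimes> Ide V a) \<in> Hom V (a \<otimes>\<^sub>o a \<otimes>\<^sub>o a) (a \<otimes>\<^sub>o a \<otimes>\<^sub>o a)"
    by (simp add: endo_simps)
  from Comp_Ide[OF _ _ this] show ?thesis
    by (simp add: coherence_simps endo_simps flat_inv_def inv_arrow_Ide flat_simps del: flat.simps)
qed

lemma phi_zero_one: "phi (duoidal_D V) [[], [q]] = (Ide V (Unit V) \<otimes> \<beta>) \<cdot> lunit_inv V a"
proof -
  have "Ide V (Unit V) \<otimes> \<beta> \<in> Hom V (Unit V \<otimes>\<^sub>o a) (Unit V \<otimes>\<^sub>o a)"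
    by (simp add: endo_simps)
  from Ide_Comp[OF _ _ this] show ?thesis
    by (simp add: coherence_simps endo_simps flat_inv_def lunit_inv_def flat_simps del: flat.simps)
qed

lemma phi_one_zero:
  "phi (duoidal_D V) [[q], []]
    = (\<alpha> \<otimes> Ide V (Unit V)) \<cdot> inv_arrow V (a \<otimes>\<^sub>o Unit V) a (runit V a)"
proof -
  have "\<alpha> \<otimes> Ide V (Unit V) \<in> Hom V (a \<otimes>\<^sub>o Unit V) (a \<otimes>\<^sub>o Unit V)"
    by (simp add: endo_simps)
  from Ide_Comp[OF _ _ this] show ?thesis
    by (simp add: coherence_simps endo_simps flat_inv_def flat_simps del: flat.simps)
qed

text \<open>By naturality of the unit isomorphisms, \<open>\<psi>\<close> takes the form in which it occurs in the unit laws.\<close>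

lemma psi_zero_one: "psi (duoidal_D V) [[], [q]] = \<nu> \<cdot> lunit V a"
proof -
  have "lunit V a \<cdot> (Ide V (Unit V) \<otimes> \<nu>) = \<nu> \<cdot> lunit V a"
    by (rule lunit_natural) (simp_all add: endo_simps)
  moreover have "\<nu> \<cdot> lunit V a \<in> Hom V (Unit V \<otimes>\<^sub>o a) a"
    by (rule Comp_in_Hom[where b = a]) (simp_all add: endo_simps)
  note Comp_Ide[OF _ _ this]
  ultimately show ?thesis
    by (simp add: coherence_simps endo_simps flat_inv_def inv_arrow_Ide flat_simps del: flat.simps)
qed

lemma psi_one_zero: "psi (duoidal_D V) [[q], []] = \<kappa> \<cdot> runit V a"
proof -
  have "runit V a \<cdot> (\<kappa> \<otimes> Ide V (Unit V)) = \<kappa> \<cdot> runit V a"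
    by (rule runit_natural) (simp_all add: endo_simps)
  moreover have "\<kappa> \<cdot> runit V a \<in> Hom V (a \<otimes>\<^sub>o Unit V) a"
    by (rule Comp_in_Hom[where b = a]) (simp_all add: endo_simps)
  note Comp_Ide[OF _ _ this]
  ultimately show ?thesis
    by (simp add: coherence_simps endo_simps flat_inv_def inv_arrow_Ide flat_simps del: flat.simps)
qed

lemma xi_two_two: "xi (duoidal_D V) 2 [[q, q], [q, q]] = middle_four V a a a a"
proof -
  have "middle_four V a a a a \<in> Hom V ((a \<otimes>\<^sub>o a) \<otimes>\<^sub>o (a \<otimes>\<^sub>o a)) ((a \<otimes>\<^sub>o a) \<otimes>\<^sub>o (a \<otimes>\<^sub>o a))"
    by (simp add: middle_four_in_Hom a_Obj)
  from Comp_Ide[OF _ _ this] Ide_Comp[OF _ _ this] show ?thesis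
    by (simp add: duoidal_D_def Let_def columns_def numeral_2_eq_2 TArr_Ide endo_simps)
qed

lemma xi_zero_two: "xi (duoidal_D V) 0 [[], []] = lunit V (Unit V)"
  by (simp add: duoidal_D_def Let_def columns_def TArr_Ide endo_simps Comp_Ide[OF _ _ lunit_in_Hom])

lemma xi_two_zero: "xi (duoidal_D V) 2 [] = lunit_inv V (Unit V)"
  by (simp add: duoidal_D_def Let_def numeral_2_eq_2 flat_inv_def lunit_inv_def flat_simps del: flat.simps)

lemma xi_zero_zero: "xi (duoidal_D V) 0 [] = Ide V (Unit V)"
  by (simp add: duoidal_D_def Let_def flat_inv_def inv_arrow_Ide Unit_Obj)

lemmas data_simps =
  Phi_two_one Phi_one_two Psi_two_one Psi_one_two phi_zero_one phi_one_zero psi_zero_one psi_one_zero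
  xi_two_two xi_zero_two xi_two_zero xi_zero_zero

section \<open>Comparison of the objects\<close>

text \<open>
  Associativity in \<open>\<D>\<close> starts at \<open>a \<otimes> (a \<otimes> a)\<close>, where \<open>\<Psi>\<^sub>2\<^sub>,\<^sub>1\<close> contains the inverse associativity
  isomorphism, whereas BiHom-associativity starts at \<open>(a \<otimes> a) \<otimes> a\<close>.
\<close>

lemma associativity_iff:
  assumes \<mu>: "\<mu> \<in> Hom V (a \<otimes>\<^sub>o a) a"
  shows "\<mu> \<cdot> (\<mu> \<otimes> Ide V a) \<cdot> (((Ide V a \<otimes> Ide V a) \<otimes> \<nu>) \<cdot> assoc_inv V a a a)
           = \<mu> \<cdot> (Ide V a \<otimes> \<mu>) \<cdot> (\<kappa> \<otimes> (Ide V a \<otimes> Ide V a))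
         \<longleftrightarrow> \<mu> \<cdot> (\<mu> \<otimes> Ide V a) \<cdot> ((Ide V a \<otimes> Ide V a) \<otimes> \<nu>)
           = \<mu> \<cdot> (Ide V a \<otimes> \<mu>) \<cdot> (\<kappa> \<otimes> (Ide V a \<otimes> Ide V a)) \<cdot> assoc V a a a"
proof -
  let ?f = "\<mu> \<cdot> (\<mu> \<otimes> Ide V a)" and ?n = "(Ide V a \<otimes> Ide V a) \<otimes> \<nu>"
  have f: "?f \<in> Hom V ((a \<otimes>\<^sub>o a) \<otimes>\<^sub>o a) a"
    by (rule Comp_in_Hom[where b = "a \<otimes>\<^sub>o a"]) (simp_all add: endo_simps \<mu>)
  have n: "?n \<in> Hom V ((a \<otimes>\<^sub>o a) \<otimes>\<^sub>o a) ((a \<otimes>\<^sub>o a) \<otimes>\<^sub>o a)"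
    by (simp add: endo_simps)
  have "?f \<cdot> (?n \<cdot> assoc_inv V a a a) = ?f \<cdot> ?n \<cdot> assoc_inv V a a a"
    using Comp_assoc[OF _ _ _ _ assoc_inv_in_Hom n f] by (simp add: endo_simps)
  moreover have fn: "?f \<cdot> ?n \<in> Hom V ((a \<otimes>\<^sub>o a) \<otimes>\<^sub>o a) a"
    using Comp_in_Hom[OF _ _ _ n f] by (simp add: endo_simps)
  moreover have k: "\<mu> \<cdot> (Ide V a \<otimes> \<mu>) \<cdot> (\<kappa> \<otimes> (Ide V a \<otimes> Ide V a)) \<in> Hom V (a \<otimes>\<^sub>o a \<otimes>\<^sub>o a) a"
    by (intro Comp_in_Hom[where b = "a \<otimes>\<^sub>o a \<otimes>\<^sub>o a"] Comp_in_Hom[where b = "a \<otimes>\<^sub>o a"])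
      (simp_all add: endo_simps \<mu>)
  ultimately show ?thesis
    using Comp_inverse_right_eq_iff[OF _ _ _ assoc_inverse fn k] by (simp add: endo_simps)
qed

text \<open>The factor \<open>Ide V a\<close> is \<open>\<iota>\<close>, and the composite that precedes it is \<open>\<phi>\<^sub>0\<^sub>,\<^sub>1\<close> (respectively \<open>\<phi>\<^sub>1\<^sub>,\<^sub>0\<close>).\<close>

lemma left_counit_iff:
  assumes \<delta>: "\<delta> \<in> Hom V a (a \<otimes>\<^sub>o a)" and \<epsilon>: "\<epsilon> \<in> Hom V a (Unit V)"
  shows "(\<epsilon> \<otimes> Ide V a) \<cdot> \<delta> = (Ide V (Unit V) \<otimes> \<beta>) \<cdot> lunit_inv V a \<cdot> Ide V a
         \<longleftrightarrow> lunit V a \<cdot> (\<epsilon> \<otimes> Ide V a) \<cdot> \<delta> = \<beta>"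
proof -
  have inv: "inverse_arrows V (Unit V \<otimes>\<^sub>o a) a (lunit V a) (lunit_inv V a)"
    by (simp add: lunit_inverse a_Obj)
  then have li: "lunit_inv V a \<in> Hom V a (Unit V \<otimes>\<^sub>o a)"
    by (simp add: inverse_arrows_def)
  have b: "Ide V (Unit V) \<otimes> \<beta> \<in> Hom V (Unit V \<otimes>\<^sub>o a) (Unit V \<otimes>\<^sub>o a)"
    and e: "\<epsilon> \<otimes> Ide V a \<in> Hom V (a \<otimes>\<^sub>o a) (Unit V \<otimes>\<^sub>o a)"
    by (simp_all add: endo_simps \<epsilon>)
  have ed: "(\<epsilon> \<otimes> Ide V a) \<cdot> \<delta> \<in> Hom V a (Unit V \<otimes>\<^sub>o a)"
    using Comp_in_Hom[OF _ _ _ \<delta> e] by (simp add: endo_simps)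
  have "lunit V a \<cdot> (Ide V (Unit V) \<otimes> \<beta>) = \<beta> \<cdot> lunit V a"
    by (rule lunit_natural) (simp_all add: endo_simps)
  moreover have "(Ide V (Unit V) \<otimes> \<beta>) \<cdot> lunit_inv V a \<cdot> Ide V a = (Ide V (Unit V) \<otimes> \<beta>) \<cdot> lunit_inv V a"
    using Comp_Ide[OF _ _ Comp_in_Hom[OF _ _ _ li b]] by (simp add: endo_simps)
  moreover have "lunit V a \<cdot> (\<epsilon> \<otimes> Ide V a) \<cdot> \<delta> = lunit V a \<cdot> ((\<epsilon> \<otimes> Ide V a) \<cdot> \<delta>)"
    using Comp_assoc[OF _ _ _ _ \<delta> e lunit_in_Hom] by (simp add: endo_simps)
  ultimately show ?thesis
    using Comp_intertwiner_inverse_eq_iff[OF _ _ inv b _ _ ed, of \<beta>] by (simp add: endo_simps)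
qed

lemma right_counit_iff:
  assumes \<delta>: "\<delta> \<in> Hom V a (a \<otimes>\<^sub>o a)" and \<epsilon>: "\<epsilon> \<in> Hom V a (Unit V)"
  shows "(Ide V a \<otimes> \<epsilon>) \<cdot> \<delta>
           = (\<alpha> \<otimes> Ide V (Unit V)) \<cdot> inv_arrow V (a \<otimes>\<^sub>o Unit V) a (runit V a) \<cdot> Ide V a
         \<longleftrightarrow> runit V a \<cdot> (Ide V a \<otimes> \<epsilon>) \<cdot> \<delta> = \<alpha>"
proof -
  define ri where "ri = inv_arrow V (a \<otimes>\<^sub>o Unit V) a (runit V a)"
  have inv: "inverse_arrows V (a \<otimes>\<^sub>o Unit V) a (runit V a) ri"
    by (simp add: runit_inverse a_Obj ri_def)
  then have ri: "ri \<in> Hom V a (a \<otimes>\<^sub>o Unit V)"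
    by (simp add: inverse_arrows_def)
  have b: "\<alpha> \<otimes> Ide V (Unit V) \<in> Hom V (a \<otimes>\<^sub>o Unit V) (a \<otimes>\<^sub>o Unit V)"
    and e: "Ide V a \<otimes> \<epsilon> \<in> Hom V (a \<otimes>\<^sub>o a) (a \<otimes>\<^sub>o Unit V)"
    by (simp_all add: endo_simps \<epsilon>)
  have ed: "(Ide V a \<otimes> \<epsilon>) \<cdot> \<delta> \<in> Hom V a (a \<otimes>\<^sub>o Unit V)"
    using Comp_in_Hom[OF _ _ _ \<delta> e] by (simp add: endo_simps)
  have "runit V a \<cdot> (\<alpha> \<otimes> Ide V (Unit V)) = \<alpha> \<cdot> runit V a"
    by (rule runit_natural) (simp_all add: endo_simps)
  moreover have "(\<alpha> \<otimes> Ide V (Unit V)) \<cdot> ri \<cdot> Ide V a = (\<alpha> \<otimes> Ide V (Unit V)) \<cdot> ri"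
    using Comp_Ide[OF _ _ Comp_in_Hom[OF _ _ _ ri b]] by (simp add: endo_simps)
  moreover have "runit V a \<cdot> (Ide V a \<otimes> \<epsilon>) \<cdot> \<delta> = runit V a \<cdot> ((Ide V a \<otimes> \<epsilon>) \<cdot> \<delta>)"
    using Comp_assoc[OF _ _ _ _ \<delta> e runit_in_Hom] by (simp add: endo_simps)
  ultimately show ?thesis
    using Comp_intertwiner_inverse_eq_iff[OF _ _ inv b _ _ ed, of \<alpha>]
    by (simp add: endo_simps flip: ri_def)
qed

lemma Ide_Comp_psi:
  "Ide V a \<cdot> (\<nu> \<cdot> lunit V a) = \<nu> \<cdot> lunit V a" "Ide V a \<cdot> (\<kappa> \<cdot> runit V a) = \<kappa> \<cdot> runit V a"
proof -
  have "\<nu> \<cdot> lunit V a \<in> Hom V (Unit V \<otimes>\<^sub>o a) a" "\<kappa> \<cdot> runit V a \<in> Hom V (a \<otimes>\<^sub>o Unit V) a"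
    by (rule Comp_in_Hom[where b = a]; simp add: endo_simps)+
  from this[THEN Ide_Comp[rotated 2]] show
    "Ide V a \<cdot> (\<nu> \<cdot> lunit V a) = \<nu> \<cdot> lunit V a" "Ide V a \<cdot> (\<kappa> \<cdot> runit V a) = \<kappa> \<cdot> runit V a"
    by (simp_all add: endo_simps)
qed

lemma bisemigroup_iff_bihom_bimonoid:
  "bisemigroup (duoidal_D V) q \<delta> \<mu> \<longleftrightarrow> bihom_bimonoid V a \<kappa> \<nu> \<mu> \<alpha> \<beta> \<delta>"
  using quad_object associativity_iff[of \<mu>]
  by (auto simp: bisemigroup_def bihom_bimonoid_def bihom_monoid_def bihom_comonoid_def
      duoidal_D_simps data_simps quad_tens_def quad_hom_def quad_objects_def commute_def)

lemma bimonoid_iff_unital_counital: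
  "bimonoid (duoidal_D V) q \<delta> \<mu> \<epsilon> \<eta>
     \<longleftrightarrow> unital_counital_bihom_bimonoid V a \<kappa> \<nu> \<mu> \<alpha> \<beta> \<delta> \<eta> \<epsilon>"
proof (cases "bisemigroup (duoidal_D V) q \<delta> \<mu> \<and> \<epsilon> \<in> Hom V a (Unit V) \<and> \<eta> \<in> Hom V (Unit V) a")
  case True
  then have "\<delta> \<in> Hom V a (a \<otimes>\<^sub>o a)"
    by (simp add: bisemigroup_iff_bihom_bimonoid bihom_bimonoid_def bihom_comonoid_def)
  moreover have "Ide V (Unit V) \<cdot> \<epsilon> = \<epsilon>" "\<eta> \<cdot> Ide V (Unit V) = \<eta>"
    using True Ide_Comp Comp_Ide a_Obj Unit_Obj by blast+
  ultimately show ?thesis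
    using True left_counit_iff[of \<delta> \<epsilon>] right_counit_iff[of \<delta> \<epsilon>]
    by (auto simp: bimonoid_def unital_counital_bihom_bimonoid_def bisemigroup_iff_bihom_bimonoid
        bihom_unit_def bihom_counit_def duoidal_D_simps data_simps quad_tens_def quad_hom_def
        Ide_Comp_psi)
next
  case False
  then show ?thesis
    by (auto simp: bimonoid_def unital_counital_bihom_bimonoid_def bisemigroup_iff_bihom_bimonoid
        bihom_unit_def bihom_counit_def duoidal_D_simps quad_tens_def quad_hom_def)
qed

end

context symmetric_monoidal_category
begin

lemma quad_object_if_bihom_bimonoid:
  "bihom_bimonoid V a \<kappa> \<nu> \<mu> \<alpha> \<beta> \<delta> \<Longrightarrow> Quad a \<alpha> \<beta> \<kappa> \<nu> \<in> quad_objects V"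
  by (simp add: bihom_bimonoid_def bihom_monoid_def bihom_comonoid_def quad_objects_def)

lemma bisemigroup_iff:
  "bisemigroup (duoidal_D V) (Quad a \<alpha> \<beta> \<kappa> \<nu>) \<delta> \<mu> \<longleftrightarrow> bihom_bimonoid V a \<kappa> \<nu> \<mu> \<alpha> \<beta> \<delta>"
proof (cases "Quad a \<alpha> \<beta> \<kappa> \<nu> \<in> quad_objects V")
  case True
  then interpret quad_object V a \<alpha> \<beta> \<kappa> \<nu>
    by unfold_locales
  show ?thesis
    by (rule bisemigroup_iff_bihom_bimonoid)
next
  case False
  then show ?thesis
    using quad_object_if_bihom_bimonoid[of a \<kappa> \<nu> \<mu> \<alpha> \<beta> \<delta>]
    by (auto simp: bisemigroup_def duoidal_D_def Let_def)
qed

lemma bimonoid_iff: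
  "bimonoid (duoidal_D V) (Quad a \<alpha> \<beta> \<kappa> \<nu>) \<delta> \<mu> \<epsilon> \<eta>
     \<longleftrightarrow> unital_counital_bihom_bimonoid V a \<kappa> \<nu> \<mu> \<alpha> \<beta> \<delta> \<eta> \<epsilon>"
proof (cases "Quad a \<alpha> \<beta> \<kappa> \<nu> \<in> quad_objects V")
  case True
  then interpret quad_object V a \<alpha> \<beta> \<kappa> \<nu>
    by unfold_locales
  show ?thesis
    by (rule bimonoid_iff_unital_counital)
next
  case False
  then show ?thesis
    using quad_object_if_bihom_bimonoid[of a \<kappa> \<nu> \<mu> \<alpha> \<beta> \<delta>]
    by (auto simp: bimonoid_def bisemigroup_def unital_counital_bihom_bimonoid_def duoidal_D_def Let_def)
qed

section \<open>Comparison of the categories\<close>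

lemma bihom_bimonoid_morphism_Ide:
  assumes "bihom_bimonoid V a \<kappa> \<nu> \<mu> \<alpha> \<beta> \<delta>"
  shows "bihom_bimonoid_morphism V (a, \<kappa>, \<nu>, \<mu>, \<alpha>, \<beta>, \<delta>) (a, \<kappa>, \<nu>, \<mu>, \<alpha>, \<beta>, \<delta>) (Ide V a)"
proof -
  have a: "a \<in> Obj V" "a \<otimes>\<^sub>o a \<in> Obj V"
    and endo: "\<kappa> \<in> Hom V a a" "\<nu> \<in> Hom V a a" "\<alpha> \<in> Hom V a a" "\<beta> \<in> Hom V a a"
    and \<mu>: "\<mu> \<in> Hom V (a \<otimes>\<^sub>o a) a" and \<delta>: "\<delta> \<in> Hom V a (a \<otimes>\<^sub>o a)"
    using assms by (auto simp: bihom_bimonoid_def bihom_monoid_def bihom_comonoid_def TObj_Obj)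
  show ?thesis
    using a endo Comp_Ide[of a a] Ide_Comp[of a a]
      Comp_Ide[OF _ _ \<mu>] Ide_Comp[OF _ _ \<mu>] Comp_Ide[OF _ _ \<delta>] Ide_Comp[OF _ _ \<delta>]
    by (simp add: bihom_bimonoid_morphism_def Ide_in_Hom TArr_Ide)
qed

text \<open>Pasting of two commutative squares.\<close>

lemma Comp_intertwines:
  assumes "a \<in> Obj V" "b \<in> Obj V" "c \<in> Obj V" "a' \<in> Obj V" "b' \<in> Obj V" "c' \<in> Obj V"
    and "f \<in> Hom V a b" "g \<in> Hom V b c" "f' \<in> Hom V a' b'" "g' \<in> Hom V b' c'"
    and "s \<in> Hom V a a'" "t \<in> Hom V b b'" "u \<in> Hom V c c'"
    and "t \<cdot> f = f' \<cdot> s" "u \<cdot> g = g' \<cdot> t"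
  shows "u \<cdot> (g \<cdot> f) = (g' \<cdot> f') \<cdot> s"
proof -
  have "u \<cdot> (g \<cdot> f) = (u \<cdot> g) \<cdot> f"
    using assms Comp_assoc[of a b c c' f g u] by simp
  also have "\<dots> = g' \<cdot> (t \<cdot> f)"
    using assms Comp_assoc[of a b b' c' f t g'] by simp
  also have "\<dots> = (g' \<cdot> f') \<cdot> s"
    using assms Comp_assoc[of a a' b' c' s f' g'] by simp
  finally show ?thesis .
qed

lemma bihom_bimonoid_morphism_Comp:
  assumes X: "bihom_bimonoid V a \<kappa> \<nu> \<mu> \<alpha> \<beta> \<delta>"
    and Y: "bihom_bimonoid V a' \<kappa>' \<nu>' \<mu>' \<alpha>' \<beta>' \<delta>'"
    and W: "bihom_bimonoid V a'' \<kappa>'' \<nu>'' \<mu>'' \<alpha>'' \<beta>'' \<delta>''"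
    and f: "bihom_bimonoid_morphism V (a, \<kappa>, \<nu>, \<mu>, \<alpha>, \<beta>, \<delta>) (a', \<kappa>', \<nu>', \<mu>', \<alpha>', \<beta>', \<delta>') f"
    and g: "bihom_bimonoid_morphism V (a', \<kappa>', \<nu>', \<mu>', \<alpha>', \<beta>', \<delta>') (a'', \<kappa>'', \<nu>'', \<mu>'', \<alpha>'', \<beta>'', \<delta>'') g"
  shows "bihom_bimonoid_morphism V (a, \<kappa>, \<nu>, \<mu>, \<alpha>, \<beta>, \<delta>) (a'', \<kappa>'', \<nu>'', \<mu>'', \<alpha>'', \<beta>'', \<delta>'') (g \<cdot> f)"
proof -
  have obj: "a \<in> Obj V" "a' \<in> Obj V" "a'' \<in> Obj V"
    "a \<otimes>\<^sub>o a \<in> Obj V" "a' \<otimes>\<^sub>o a' \<in> Obj V" "a'' \<otimes>\<^sub>o a'' \<in> Obj V"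
    using X Y W by (auto simp: bihom_bimonoid_def bihom_comonoid_def TObj_Obj)
  have fg: "f \<in> Hom V a a'" "g \<in> Hom V a' a''"
    using f g by (simp_all add: bihom_bimonoid_morphism_def)
  have ff: "f \<otimes> f \<in> Hom V (a \<otimes>\<^sub>o a) (a' \<otimes>\<^sub>o a')" and gg: "g \<otimes> g \<in> Hom V (a' \<otimes>\<^sub>o a') (a'' \<otimes>\<^sub>o a'')"
    using obj fg by (simp_all add: TArr_in_Hom)
  have tens: "(g \<cdot> f) \<otimes> (g \<cdot> f) = (g \<otimes> g) \<cdot> (f \<otimes> f)"
    using obj fg TArr_Comp[of a a' a'' a a' a'' f g f g] by simp
  have endo: "(g \<cdot> f) \<cdot> s = u \<cdot> (g \<cdot> f)"
    if "s \<in> Hom V a a" "t \<in> Hom V a' a'" "u \<in> Hom V a'' a''" "f \<cdot> s = t \<cdot> f" "g \<cdot> t = u \<cdot> g" for s t u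
    using Comp_intertwines[of a a' a'' a a' a'' f g f g s t u] obj fg that by simp
  have "\<delta>'' \<cdot> (g \<cdot> f) = (g \<otimes> g) \<cdot> (f \<otimes> f) \<cdot> \<delta>"
    using X Y W f g obj fg ff gg
    by (intro Comp_intertwines[where t = \<delta>'])
      (auto simp: bihom_bimonoid_def bihom_comonoid_def bihom_bimonoid_morphism_def)
  moreover have "(g \<cdot> f) \<cdot> \<mu> = \<mu>'' \<cdot> ((g \<otimes> g) \<cdot> (f \<otimes> f))"
    using X Y W f g obj fg ff gg
    by (intro Comp_intertwines[where t = \<mu>', symmetric])
      (auto simp: bihom_bimonoid_def bihom_monoid_def bihom_bimonoid_morphism_def)
  moreover have "(g \<cdot> f) \<cdot> \<kappa> = \<kappa>'' \<cdot> (g \<cdot> f)" "(g \<cdot> f) \<cdot> \<nu> = \<nu>'' \<cdot> (g \<cdot> f)"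
    "(g \<cdot> f) \<cdot> \<alpha> = \<alpha>'' \<cdot> (g \<cdot> f)" "(g \<cdot> f) \<cdot> \<beta> = \<beta>'' \<cdot> (g \<cdot> f)"
    using X Y W f g
    by (auto simp: bihom_bimonoid_def bihom_monoid_def bihom_comonoid_def bihom_bimonoid_morphism_def
        intro: endo[of _ \<kappa>'] endo[of _ \<nu>'] endo[of _ \<alpha>'] endo[of _ \<beta>'])
  moreover have "g \<cdot> f \<in> Hom V a a''"
    using obj fg Comp_in_Hom by blast
  ultimately show ?thesis
    by (simp add: bihom_bimonoid_morphism_def tens)
qed

lemma category_bihom_bimonoids: "category (bihom_bimonoids V)"
proof (rule concrete_category[where U = fst])
  fix X Y W f g
  assume "X \<in> Obj (bihom_bimonoids V)" "Y \<in> Obj (bihom_bimonoids V)" "W \<in> Obj (bihom_bimonoids V)"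
    and "f \<in> Hom (bihom_bimonoids V) X Y" "g \<in> Hom (bihom_bimonoids V) Y W"
  then show "g \<cdot> f \<in> Hom (bihom_bimonoids V) X W"
    unfolding bihom_bimonoids_def by (auto intro: bihom_bimonoid_morphism_Comp)
next
  fix X assume "X \<in> Obj (bihom_bimonoids V)"
  then show "Ide V (fst X) \<in> Hom (bihom_bimonoids V) X X"
    unfolding bihom_bimonoids_def by (auto intro: bihom_bimonoid_morphism_Ide)
qed (auto simp: bihom_bimonoids_def bihom_bimonoid_def bihom_monoid_def bihom_bimonoid_morphism_def)

lemma category_unital_counital_bihom_bimonoids: "category (unital_counital_bihom_bimonoids V)"
proof (rule concrete_category[where U = fst])
  fix X Y W f g
  assume "X \<in> Obj (unital_counital_bihom_bimonoids V)" "Y \<in> Obj (unital_counital_bihom_bimonoids V)"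
    "W \<in> Obj (unital_counital_bihom_bimonoids V)"
    and fg: "f \<in> Hom (unital_counital_bihom_bimonoids V) X Y"
      "g \<in> Hom (unital_counital_bihom_bimonoids V) Y W"
  then obtain a \<kappa> \<nu> \<mu> \<alpha> \<beta> \<delta> \<eta> \<epsilon> a' \<kappa>' \<nu>' \<mu>' \<alpha>' \<beta>' \<delta>' \<eta>' \<epsilon>' a'' \<kappa>'' \<nu>'' \<mu>'' \<alpha>'' \<beta>'' \<delta>'' \<eta>'' \<epsilon>''
    where eqs: "X = (a, \<kappa>, \<nu>, \<mu>, \<alpha>, \<beta>, \<delta>, \<eta>, \<epsilon>)" "Y = (a', \<kappa>', \<nu>', \<mu>', \<alpha>', \<beta>', \<delta>', \<eta>', \<epsilon>')"
      "W = (a'', \<kappa>'', \<nu>'', \<mu>'', \<alpha>'', \<beta>'', \<delta>'', \<eta>'', \<epsilon>'')"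
    and X: "unital_counital_bihom_bimonoid V a \<kappa> \<nu> \<mu> \<alpha> \<beta> \<delta> \<eta> \<epsilon>"
    and Y: "unital_counital_bihom_bimonoid V a' \<kappa>' \<nu>' \<mu>' \<alpha>' \<beta>' \<delta>' \<eta>' \<epsilon>'"
    and W: "unital_counital_bihom_bimonoid V a'' \<kappa>'' \<nu>'' \<mu>'' \<alpha>'' \<beta>'' \<delta>'' \<eta>'' \<epsilon>''"
    by (auto simp: unital_counital_bihom_bimonoids_def)
  have f: "bihom_bimonoid_morphism V (a, \<kappa>, \<nu>, \<mu>, \<alpha>, \<beta>, \<delta>) (a', \<kappa>', \<nu>', \<mu>', \<alpha>', \<beta>', \<delta>') f"
      "f \<cdot> \<eta> = \<eta>'" "\<epsilon>' \<cdot> f = \<epsilon>"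
    and g: "bihom_bimonoid_morphism V (a', \<kappa>', \<nu>', \<mu>', \<alpha>', \<beta>', \<delta>') (a'', \<kappa>'', \<nu>'', \<mu>'', \<alpha>'', \<beta>'', \<delta>'') g"
      "g \<cdot> \<eta>' = \<eta>''" "\<epsilon>'' \<cdot> g = \<epsilon>'"
    using fg by (simp_all add: unital_counital_bihom_bimonoids_def eqs)
  have obj: "a \<in> Obj V" "a' \<in> Obj V" "a'' \<in> Obj V"
    and hom: "f \<in> Hom V a a'" "g \<in> Hom V a' a''" "\<eta> \<in> Hom V (Unit V) a" "\<epsilon>'' \<in> Hom V a'' (Unit V)"
    using X Y W f(1) g(1)
    by (auto simp: unital_counital_bihom_bimonoid_def bihom_bimonoid_def bihom_monoid_def
        bihom_unit_def bihom_counit_def bihom_bimonoid_morphism_def)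
  have "g \<cdot> f \<cdot> \<eta> = \<eta>''"
    using Comp_assoc[of "Unit V" a a' a'' \<eta> f g] obj hom f g by (simp add: Unit_Obj)
  moreover have "\<epsilon>'' \<cdot> (g \<cdot> f) = \<epsilon>"
    using Comp_assoc[of a a' a'' "Unit V" f g \<epsilon>''] obj hom f g by (simp add: Unit_Obj)
  moreover have "bihom_bimonoid_morphism V (a, \<kappa>, \<nu>, \<mu>, \<alpha>, \<beta>, \<delta>) (a'', \<kappa>'', \<nu>'', \<mu>'', \<alpha>'', \<beta>'', \<delta>'') (g \<cdot> f)"
    using X Y W f(1) g(1) unfolding unital_counital_bihom_bimonoid_def
    by (blast intro: bihom_bimonoid_morphism_Comp)
  ultimately show "g \<cdot> f \<in> Hom (unital_counital_bihom_bimonoids V) X W"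
    by (simp add: unital_counital_bihom_bimonoids_def eqs)
next
  fix X assume "X \<in> Obj (unital_counital_bihom_bimonoids V)"
  then obtain a \<kappa> \<nu> \<mu> \<alpha> \<beta> \<delta> \<eta> \<epsilon>
    where eq: "X = (a, \<kappa>, \<nu>, \<mu>, \<alpha>, \<beta>, \<delta>, \<eta>, \<epsilon>)"
    and X: "unital_counital_bihom_bimonoid V a \<kappa> \<nu> \<mu> \<alpha> \<beta> \<delta> \<eta> \<epsilon>"
    by (auto simp: unital_counital_bihom_bimonoids_def)
  have "a \<in> Obj V" "\<eta> \<in> Hom V (Unit V) a" "\<epsilon> \<in> Hom V a (Unit V)"
    using X by (simp_all add: unital_counital_bihom_bimonoid_def bihom_unit_def bihom_counit_def
        bihom_bimonoid_def bihom_monoid_def)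
  then have "Ide V a \<cdot> \<eta> = \<eta>" "\<epsilon> \<cdot> Ide V a = \<epsilon>"
    using Ide_Comp Comp_Ide Unit_Obj by blast+
  with X show "Ide V (fst X) \<in> Hom (unital_counital_bihom_bimonoids V) X X"
    by (simp add: unital_counital_bihom_bimonoids_def unital_counital_bihom_bimonoid_def eq
        bihom_bimonoid_morphism_Ide)
qed (auto simp: unital_counital_bihom_bimonoids_def unital_counital_bihom_bimonoid_def
    bihom_bimonoid_def bihom_monoid_def bihom_bimonoid_morphism_def)

lemma bisemigroup_morphism_iff:
  "bisemigroup_morphism (duoidal_D V) (Quad a \<alpha> \<beta> \<kappa> \<nu>, \<delta>, \<mu>) (Quad a' \<alpha>' \<beta>' \<kappa>' \<nu>', \<delta>', \<mu>') f
     \<longleftrightarrow> bihom_bimonoid_morphism V (a, \<kappa>, \<nu>, \<mu>, \<alpha>, \<beta>, \<delta>) (a', \<kappa>', \<nu>', \<mu>', \<alpha>', \<beta>', \<delta>') f"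
  by (auto simp: bisemigroup_morphism_def bihom_bimonoid_morphism_def duoidal_D_def Let_def quad_hom_def)

lemma isomorphic_bisemigroups_bihom_bimonoids:
  "isomorphic_categories (bisemigroups (duoidal_D V)) (bihom_bimonoids V)"
proof (rule isomorphic_categories_if_same_arrows[OF category_bihom_bimonoids,
    where F = "\<lambda>(x, \<delta>, \<mu>). (und x, ka x, nu x, \<mu>, al x, be x, \<delta>)"
      and G = "\<lambda>(a, \<kappa>, \<nu>, \<mu>, \<alpha>, \<beta>, \<delta>). (Quad a \<alpha> \<beta> \<kappa> \<nu>, \<delta>, \<mu>)"], goal_cases)
  case (1 X)
  then show ?case
    by (cases X; cases "fst X") (auto simp: bisemigroups_def bihom_bimonoids_def bisemigroup_iff)
next
  case (5 X Y)
  then show ?case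
    by (cases X; cases Y; cases "fst X"; cases "fst Y")
      (auto simp: bisemigroups_def bihom_bimonoids_def bisemigroup_morphism_iff)
qed (auto simp: bisemigroups_def bihom_bimonoids_def bisemigroup_iff duoidal_D_simps)

lemma isomorphic_bimonoids_unital_counital_bihom_bimonoids:
  "isomorphic_categories (bimonoids (duoidal_D V)) (unital_counital_bihom_bimonoids V)"
proof (rule isomorphic_categories_if_same_arrows[OF category_unital_counital_bihom_bimonoids,
    where F = "\<lambda>(x, \<delta>, \<mu>, \<epsilon>, \<eta>). (und x, ka x, nu x, \<mu>, al x, be x, \<delta>, \<eta>, \<epsilon>)"
      and G = "\<lambda>(a, \<kappa>, \<nu>, \<mu>, \<alpha>, \<beta>, \<delta>, \<eta>, \<epsilon>). (Quad a \<alpha> \<beta> \<kappa> \<nu>, \<delta>, \<mu>, \<epsilon>, \<eta>)"], goal_cases)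
  case (1 X)
  then show ?case
    by (cases X; cases "fst X")
      (auto simp: bimonoids_def unital_counital_bihom_bimonoids_def bimonoid_iff)
next
  case (5 X Y)
  then show ?case
    by (cases X; cases Y; cases "fst X"; cases "fst Y")
      (auto simp: bimonoids_def unital_counital_bihom_bimonoids_def bisemigroup_morphism_iff
        duoidal_D_simps)
qed (auto simp: bimonoids_def unital_counital_bihom_bimonoids_def bimonoid_iff duoidal_D_simps)

end

theorem theorem7p12:
  fixes V :: "('o, 'm) moncat"
  assumes "symmetric_monoidal_category V"
  shows "isomorphic_categories (bisemigroups (lax_oplax_plus.truncate (duoidal_D V))) (bihom_bimonoids V)
       \<and> isomorphic_categories (bimonoids (duoidal_D V)) (unital_counital_bihom_bimonoids V)"
proof -
  interpret symmetric_monoidal_category V by fact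
  show ?thesis
    by (simp add: bisemigroups_truncate isomorphic_bisemigroups_bihom_bimonoids
        isomorphic_bimonoids_unital_counital_bihom_bimonoids)
qed

end
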